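(* Let $p>1$. For every $h\in(0,1)$, with $a_h(x)=1$ for $x\in[0,\tfrac{1-h}{2}]\cup[\tfrac{1+h}{2},1]$ and $a_h(x)=0$ for $x\in(\tfrac{1-h}{2},\tfrac{1+h}{2})$, there exists $\tilde\lambda(h)<0$ such that, for each $\lambda\leq\tilde\lambda(h)$, the problem $$-u''=\lambda u+a_h(x)u^p \ \text{ in } (0,1),\qquad u(0)=u(1)=0,$$ has at least two asymmetric positive solutions.
   Context: A solution is a function $u\in\mathcal{C}^1([0,1])$ with $u'$ absolutely continuous satisfying the equation a.e. and the boundary conditions; a positive solution satisfies $u>0$ in $(0,1)$. A solution is asymmetric if it is not symmetric, i.e. $u(x)\neq u(1-x)$ for some $x\in[0,1]$. *)

theory Defs
  imports "HOL-Analysis.Analysis"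
begin

definition abs_continuous_on :: "real \<Rightarrow> real \<Rightarrow> (real \<Rightarrow> real) \<Rightarrow> bool" where
  "abs_continuous_on a b f \<longleftrightarrow>
     (\<forall>\<epsilon>>0. \<exists>\<delta>>0. \<forall>(n::nat) (l::nat \<Rightarrow> real) (r::nat \<Rightarrow> real).
        (\<forall>i<n. a \<le> l i \<and> l i \<le> r i \<and> r i \<le> b) \<and>
        (\<forall>i j. i < j \<and> j < n \<longrightarrow> r i \<le> l j) \<and>
        (\<Sum>i<n. r i - l i) < \<delta>
        \<longrightarrow> (\<Sum>i<n. \<bar>f (r i) - f (l i)\<bar>) < \<epsilon>)"

definition a_h :: "real \<Rightarrow> real \<Rightarrow> real" where
  "a_h h x = (if (1 - h) / 2 < x \<and> x < (1 + h) / 2 then 0 else 1)"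

definition is_solution :: "real \<Rightarrow> real \<Rightarrow> (real \<Rightarrow> real) \<Rightarrow> (real \<Rightarrow> real) \<Rightarrow> bool" where
  "is_solution lam p a u \<longleftrightarrow>
     (\<exists>u'. (\<forall>x\<in>{0..1}. (u has_real_derivative u' x) (at x within {0..1})) \<and>
           continuous_on {0..1} u' \<and>
           abs_continuous_on 0 1 u' \<and>
           (AE x in lebesgue. x \<in> {0<..<1} \<longrightarrow>
              (u' has_real_derivative (- (lam * u x + a x * u x powr p))) (at x)) \<and>
           u 0 = 0 \<and> u 1 = 0)"

definition is_positive_solution :: "real \<Rightarrow> real \<Rightarrow> (real \<Rightarrow> real) \<Rightarrow> (real \<Rightarrow> real) \<Rightarrow> bool" where
  "is_positive_solution lam p a u \<longleftrightarrow> is_solution lam p a u \<and> (\<forall>x\<in>{0<..<1}. u x > 0)"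

definition asymmetric :: "(real \<Rightarrow> real) \<Rightarrow> bool" where
  "asymmetric u \<longleftrightarrow> (\<exists>x\<in>{0..1}. u x \<noteq> u (1 - x))"

end

theory Submission
  imports Defs "HOL-Complex_Analysis.Great_Picard"
begin

text \<open>
  Write \<open>lam = - m\<^sup>2\<close>, and let \<open>C\<close> be the supremum of \<open>N(u) = \<integral> a\<^sub>h (max 0 u)\<^sup>p\<^sup>+\<^sup>1\<close> over all \<open>u\<close> that
  vanish at \<open>0\<close> and \<open>1\<close> and satisfy \<open>Q(u) = \<integral> u'\<^sup>2 + m\<^sup>2 u\<^sup>2 \<le> 1\<close>. A maximising sequence \<open>u\<^sub>n\<close> has a
  uniform limit \<open>u\<close> with \<open>N(u) = C\<close>. No weak derivatives are needed to see that \<open>u\<close> is smooth: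
  if \<open>w\<close> solves \<open>- w'' + m\<^sup>2 w = a\<^sub>h (max 0 u)\<^sup>p\<close> with zero boundary values, then Young's inequality
  gives \<open>Q(w) \<le> C\<^sup>2\<close>, so that expanding the square yields \<open>Q(u\<^sub>n - w / C) \<rightarrow> 0\<close> and hence \<open>u = w / C\<close>.
  A multiple of \<open>u\<close> is then a positive solution.

  If \<open>u\<close> were symmetric, one could split it as \<open>u = k u + (1 - k) u\<close> with a cutoff \<open>k\<close> descending
  linearly from 1 to 0 over the gap where \<open>a\<^sub>h = 0\<close>. Both parts have \<open>N = C / 2\<close>, and the cutoff
  changes the energy only by a relative amount \<open>O(1 / m)\<close>, so one part has \<open>Q \<le> 1 / 2 + O(1 / m)\<close>.
  By homogeneity of degree \<open>(p + 1) / 2 > 1\<close> in \<open>Q\<close>, this part beats the maximum when \<open>m\<close> is large.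
  The second solution is the reflection of the first one.
\<close>

section \<open>The weight and calculus with finitely many exceptional points\<close>

lemma a_h_bounds: "0 \<le> a_h h x" "a_h h x \<le> 1"
  by (auto simp: a_h_def)

lemma a_h_reflect: "a_h h (1 - x) = a_h h x"
  by (auto simp: a_h_def field_simps)

text \<open>The weight jumps at the ends of the gap, so continuity does not give integrability
  directly. The product is \<open>c\<close> minus the restriction of \<open>c\<close> to the open
  gap, and both of these are integrable.\<close>

lemma a_h_mult_integrable:
  assumes "0 < h" "h < 1" "continuous_on {0..1} c"
  shows "(\<lambda>x. a_h h x * c x) integrable_on {0..1}"
proof -
  let ?I = "{(1 - h) / 2 <..< (1 + h) / 2}"
  have sub: "{(1 - h) / 2 .. (1 + h) / 2} \<subseteq> {0..1}"
    using assms by (auto simp: field_simps)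
  have "c integrable_on {(1 - h) / 2 .. (1 + h) / 2}"
    using assms(3) sub by (intro integrable_continuous_real) (rule continuous_on_subset)
  then have "c integrable_on ?I"
    by (simp add: integrable_on_open_interval_real)
  moreover have "?I \<inter> {0..1} = ?I"
    using sub by auto
  ultimately have "(\<lambda>x. if x \<in> ?I then c x else 0) integrable_on {0..1}"
    by (simp only: integrable_restrict_Int)
  moreover have "c integrable_on {0..1}"
    using assms(3) by (rule integrable_continuous_real)
  ultimately have "(\<lambda>x. c x - (if x \<in> ?I then c x else 0)) integrable_on {0..1}"
    by (intro integrable_diff)
  moreover have "(\<lambda>x. c x - (if x \<in> ?I then c x else 0)) = (\<lambda>x. a_h h x * c x)"
    by (auto simp: a_h_def fun_eq_iff)
  ultimately show ?thesis
    by simp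
qed

lemma a_h_isCont:
  assumes "0 < h" "x \<noteq> (1 - h) / 2" "x \<noteq> (1 + h) / 2"
  shows "isCont (a_h h) x"
proof -
  let ?l = "(1 - h) / 2" and ?r = "(1 + h) / 2"
  have "\<exists>U k. open U \<and> x \<in> U \<and> (\<forall>y\<in>U. a_h h y = k)"
  proof -
    consider "x < ?l" | "?l < x" "x < ?r" | "?r < x"
      using assms by linarith
    then show ?thesis
    proof cases
      case 1
      then show ?thesis by (intro exI[of _ "{..<?l}"] exI[of _ 1]) (auto simp: a_h_def)
    next
      case 2
      then show ?thesis by (intro exI[of _ "{?l<..<?r}"] exI[of _ 0]) (auto simp: a_h_def)
    next
      case 3
      then show ?thesis by (intro exI[of _ "{?r<..}"] exI[of _ 1]) (auto simp: a_h_def)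
    qed
  qed
  then obtain U k where U: "open U" "x \<in> U" "\<forall>y\<in>U. a_h h y = k"
    by blast
  have "eventually (\<lambda>y. a_h h y = k) (nhds x)"
    using U by (auto simp: eventually_nhds)
  then show ?thesis
    using isCont_cong[of "a_h h" "\<lambda>_. k" x] by simp
qed

lemma indefinite_integral_has_real_derivative:
  fixes f :: "real \<Rightarrow> real"
  assumes "f integrable_on {a..b}" "x \<in> {a<..<b}" "isCont f x"
  shows "((\<lambda>y. integral {a..y} f) has_real_derivative f x) (at x)"
proof -
  have "((\<lambda>y. integral {a..y} f) has_vector_derivative f x) (at x within ({a..b} - {}))"
    using assms by (intro integral_has_vector_derivative_continuous_at)
      (auto intro: continuous_at_imp_continuous_at_within)
  moreover have "at x within {a..b} = at x"
    using assms(2) by (intro at_within_interior) auto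
  ultimately show ?thesis
    by (simp add: has_real_derivative_iff_has_vector_derivative)
qed

text \<open>By the fundamental theorem of calculus, \<open>f\<close> is a constant plus the integral
  of \<open>g\<close>. As \<open>g\<close> is continuous on the closed interval, this integral is
  differentiable at the points of \<open>S\<close> and, one-sidedly, at the endpoints too.\<close>

lemma has_real_derivative_continuous_extension:
  fixes f g :: "real \<Rightarrow> real"
  assumes "finite S" "continuous_on {a..b} f" "continuous_on {a..b} g"
    and der: "\<And>x. x \<in> {a<..<b} - S \<Longrightarrow> (f has_real_derivative g x) (at x)"
    and x: "x \<in> {a..b}"
  shows "(f has_real_derivative g x) (at x within {a..b})"
proof -
  have "f y = f a + integral {a..y} g" if "y \<in> {a..b}" for y
  proof -
    have "(g has_integral (f y - f a)) {a..y}"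
      using that der assms(1)
      by (intro fundamental_theorem_of_calculus_interior_strong[of S])
        (auto simp flip: has_real_derivative_iff_has_vector_derivative
          intro: continuous_on_subset[OF assms(2)])
    then show ?thesis by (simp add: integral_unique)
  qed
  then have eq: "\<And>y. y \<in> {a..b} \<Longrightarrow> f a + integral {a..y} g = f y"
    by (rule sym)
  have "((\<lambda>y. f a + integral {a..y} g) has_real_derivative 0 + g x) (at x within {a..b})"
    by (intro DERIV_add DERIV_const integral_has_real_derivative assms(3) x)
  then show ?thesis
    using has_field_derivative_transform_within[OF _ zero_less_one x] eq by fastforce
qed

lemma derivative_bounded_imp_lipschitz:
  fixes f g :: "real \<Rightarrow> real"
  assumes "finite S" "continuous_on {a..b} f" "0 \<le> K"
    and der: "\<And>x. x \<in> {a<..<b} - S \<Longrightarrow> (f has_real_derivative g x) (at x)"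
    and bd: "\<And>x. x \<in> {a<..<b} - S \<Longrightarrow> \<bar>g x\<bar> \<le> K"
    and xy: "a \<le> x" "x \<le> y" "y \<le> b"
  shows "\<bar>f y - f x\<bar> \<le> K * (y - x)"
proof -
  have "(g has_integral (f y - f x)) {x..y}"
    using xy der assms(1)
    by (intro fundamental_theorem_of_calculus_interior_strong[of S])
      (auto simp flip: has_real_derivative_iff_has_vector_derivative
        intro: continuous_on_subset[OF assms(2)])
  \<comment> \<open>The endpoints join the exceptional set because the bound on \<open>g\<close> is
    assumed only in the open interval.\<close>
  moreover have "finite (S \<union> {a, b})"
    using assms(1) by simp
  ultimately have "norm (f y - f x) \<le> K * measure lborel {x..y}"
    using assms(3) bd xy by (intro has_integral_bound_real[of K "S \<union> {a, b}" g]) auto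
  then show ?thesis
    using xy by simp
qed

lemma lipschitz_imp_abs_continuous_on:
  assumes "0 \<le> K" and lip: "\<And>x y. a \<le> x \<Longrightarrow> x \<le> y \<Longrightarrow> y \<le> b \<Longrightarrow> \<bar>f y - f x\<bar> \<le> K * (y - x)"
  shows "abs_continuous_on a b f"
  unfolding abs_continuous_on_def
proof (intro allI impI)
  fix e :: real
  assume e: "0 < e"
  show "\<exists>d>0. \<forall>(n::nat) l r. (\<forall>i<n. a \<le> l i \<and> l i \<le> r i \<and> r i \<le> b) \<and>
      (\<forall>i j. i < j \<and> j < n \<longrightarrow> r i \<le> l j) \<and> (\<Sum>i<n. r i - l i) < d \<longrightarrow>
      (\<Sum>i<n. \<bar>f (r i) - f (l i)\<bar>) < e"
  \<comment> \<open>The shift to \<open>K + 1\<close> keeps the denominator positive when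
    \<open>K = 0\<close>.\<close>
  proof (intro exI[of _ "e / (K + 1)"] conjI allI impI)
    show "0 < e / (K + 1)"
      using e assms(1) by simp
    fix n :: nat and l r :: "nat \<Rightarrow> real"
    assume A: "(\<forall>i<n. a \<le> l i \<and> l i \<le> r i \<and> r i \<le> b) \<and>
      (\<forall>i j. i < j \<and> j < n \<longrightarrow> r i \<le> l j) \<and> (\<Sum>i<n. r i - l i) < e / (K + 1)"
    have "(\<Sum>i<n. \<bar>f (r i) - f (l i)\<bar>) \<le> (\<Sum>i<n. K * (r i - l i))"
      using A by (intro sum_mono lip) auto
    also have "\<dots> = K * (\<Sum>i<n. r i - l i)"
      by (simp add: sum_distrib_left)
    also have "\<dots> \<le> (K + 1) * (\<Sum>i<n. r i - l i)"
      using A by (intro mult_right_mono sum_nonneg) auto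
    also have "\<dots> < e"
      using A assms(1) by (auto simp: field_simps)
    finally show "(\<Sum>i<n. \<bar>f (r i) - f (l i)\<bar>) < e" .
  qed
qed

text \<open>As \<open>u\<close> is bounded, the equation bounds the derivative of \<open>v\<close>,
  so \<open>v\<close> is Lipschitz and hence absolutely continuous. The finite set \<open>S\<close>
  is null, which gives the equation almost everywhere, and continuity of \<open>v\<close> extends
  \<open>u' = v\<close> to the closed interval.\<close>

lemma is_positive_solutionI:
  assumes S: "finite S" and p: "0 < p" and a: "\<And>x. 0 \<le> a x" "\<And>x. a x \<le> 1"
    and u: "continuous_on {0..1} u" and v: "continuous_on {0..1} v"
    and du: "\<And>x. x \<in> {0<..<1} - S \<Longrightarrow> (u has_real_derivative v x) (at x)"
    and dv: "\<And>x. x \<in> {0<..<1} - S \<Longrightarrow>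
      (v has_real_derivative (- (lam * u x + a x * u x powr p))) (at x)"
    and u01: "u 0 = 0" "u 1 = 0" and pos: "\<And>x. x \<in> {0<..<1} \<Longrightarrow> 0 < u x"
  shows "is_positive_solution lam p a u"
proof -
  have "compact (u ` {0..1})"
    using u by (rule compact_continuous_image) simp
  then obtain B where B: "\<And>x. x \<in> {0..1} \<Longrightarrow> \<bar>u x\<bar> \<le> B"
    using compact_imp_bounded[THEN bounded_iff[THEN iffD1]] by fastforce
  have "0 \<le> B"
    using B[of 0] by simp
  let ?K = "\<bar>lam\<bar> * B + B powr p"
  have "\<bar>v y - v x\<bar> \<le> ?K * (y - x)" if "0 \<le> x" "x \<le> y" "y \<le> 1" for x y
  proof (rule derivative_bounded_imp_lipschitz[OF S v _ dv])
    fix t assume t: "t \<in> {0<..<1} - S"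
    have "\<bar>lam * u t\<bar> \<le> \<bar>lam\<bar> * B"
      using B[of t] t by (auto simp: abs_mult intro!: mult_left_mono)
    moreover have "a t * u t powr p \<le> 1 * B powr p"
      using a pos[of t] B[of t] t p by (intro mult_mono powr_mono2) auto
    moreover have "0 \<le> a t * u t powr p"
      using a by simp
    ultimately show "\<bar>- (lam * u t + a t * u t powr p)\<bar> \<le> ?K"
      by linarith
  qed (use \<open>0 \<le> B\<close> that in simp_all)
  then have "abs_continuous_on 0 1 v"
    using \<open>0 \<le> B\<close> by (intro lipschitz_imp_abs_continuous_on[of ?K]) auto
  moreover have "AE x in lebesgue. x \<in> {0<..<1} \<longrightarrow>
      (v has_real_derivative (- (lam * u x + a x * u x powr p))) (at x)"
  proof -
    have "S \<in> null_sets lebesgue"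
      using S by (simp add: negligible_iff_null_sets[symmetric] negligible_finite)
    then have "AE x in lebesgue. x \<notin> S"
      by (rule AE_not_in)
    then show ?thesis
      by eventually_elim (use dv in blast)
  qed
  moreover have "(u has_real_derivative v x) (at x within {0..1})" if "x \<in> {0..1}" for x
    by (rule has_real_derivative_continuous_extension[OF S u v du that])
  ultimately show ?thesis
    unfolding is_positive_solution_def is_solution_def using v u01 pos by blast
qed

lemma integral_reflect_unit:
  fixes f :: "real \<Rightarrow> real"
  shows "integral {0..1} (\<lambda>x. f (1 - x)) = integral {0..1} f"
proof -
  have "integral {0..1} (\<lambda>x. f (1 - x)) = integral {-1..0} (\<lambda>x. f (1 + x))"
    using Henstock_Kurzweil_Integration.integral_reflect_real[of 0 "-1" "\<lambda>x. f (1 + x)"]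
    by (simp only: minus_zero minus_minus diff_conv_add_uminus)
  also have "\<dots> = integral {0..1} f"
    unfolding integral_def integrable_on_def has_integral_shift_real_ivl_iff[of f _ 0 1 1]
    by (simp add: add.commute)
  finally show ?thesis .
qed

section \<open>The variational setting and the linear Dirichlet problem\<close>

locale indefinite_weight =
  fixes p h m :: real
  assumes p_gt_1: "1 < p" and h_pos: "0 < h" and h_lt_1: "h < 1" and m_pos: "0 < m"
begin

text \<open>An elementary substitute for the Sobolev space of functions with zero boundary values.
  The class contains the solutions of the linear problem and is stable under the piecewise linear
  cutoffs used below.\<close>

definition admissible :: "(real \<Rightarrow> real) \<Rightarrow> (real \<Rightarrow> real) \<Rightarrow> bool" where
  "admissible u g \<longleftrightarrow> continuous_on {0..1} u \<and> u 0 = 0 \<and> u 1 = 0 \<and>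
     (\<exists>S. finite S \<and> (\<forall>x\<in>{0<..<1} - S. (u has_real_derivative g x) (at x))) \<and>
     (\<lambda>x. (g x)\<^sup>2) integrable_on {0..1}"

definition energy :: "(real \<Rightarrow> real) \<Rightarrow> (real \<Rightarrow> real) \<Rightarrow> real" where
  "energy u g = integral {0..1} (\<lambda>x. (g x)\<^sup>2 + m\<^sup>2 * (u x)\<^sup>2)"

definition mass :: "(real \<Rightarrow> real) \<Rightarrow> real" where
  "mass u = integral {0..1} (\<lambda>x. a_h h x * max 0 (u x) powr (p + 1))"

text \<open>First-order form of \<open>- w'' + m\<^sup>2 w = a_h c\<close> with
  \<open>z = w'\<close>. The second derivative is prescribed only away from the two jumps of the
  weight.\<close>

definition dirichlet :: "(real \<Rightarrow> real) \<Rightarrow> (real \<Rightarrow> real) \<Rightarrow> (real \<Rightarrow> real) \<Rightarrow> bool" where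
  "dirichlet c w z \<longleftrightarrow> continuous_on {0..1} z \<and> w 0 = 0 \<and> w 1 = 0 \<and>
     (\<forall>x\<in>{0..1}. (w has_real_derivative z x) (at x within {0..1})) \<and>
     (\<forall>x\<in>{0<..<1} - {(1 - h) / 2, (1 + h) / 2}.
        (z has_real_derivative (m\<^sup>2 * w x - a_h h x * c x)) (at x))"

lemma dirichlet_continuous: "dirichlet c w z \<Longrightarrow> continuous_on {0..1} w"
  unfolding dirichlet_def by (rule DERIV_continuous_on[where D = z]) simp

lemma dirichlet_DERIV:
  assumes "dirichlet c w z" "x \<in> {0<..<1}"
  shows "(w has_real_derivative z x) (at x)"
proof -
  have "(w has_real_derivative z x) (at x within {0..1})"
    using assms unfolding dirichlet_def by simp
  moreover have "at x within {0..1} = at x"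
    using assms(2) by (intro at_within_interior) simp
  ultimately show ?thesis
    by simp
qed

lemma a_h_mult_integrable': "continuous_on {0..1} c \<Longrightarrow> (\<lambda>x. a_h h x * c x) integrable_on {0..1}"
  using a_h_mult_integrable h_pos h_lt_1 by blast

text \<open>Variation of parameters: up to the factor \<open>1 / m\<close>, the solution is
  \<open>k * sinh (m * x)\<close> minus the integral over \<open>y\<close> from 0 to
  \<open>x\<close> of \<open>sinh (m * (x - y)) * a_h h y * c y\<close>. The addition formula for
  \<open>sinh\<close> splits this integral into the terms with \<open>P\<close> and
  \<open>R\<close>.\<close>

lemma dirichlet_exists:
  assumes c: "continuous_on {0..1} c"
  obtains w z where "dirichlet c w z"
proof -
  let ?S = "{(1 - h) / 2, (1 + h) / 2}"
  define P where "P x = integral {0..x} (\<lambda>y. a_h h y * (cosh (m * y) * c y))" for x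
  define R where "R x = integral {0..x} (\<lambda>y. a_h h y * (sinh (m * y) * c y))" for x
  \<comment> \<open>Solving \<open>w 1 = 0\<close> for the coefficient of the homogeneous solution
    gives this value.\<close>
  define k where "k = (sinh m * P 1 - cosh m * R 1) / sinh m"
  define w where "w x = (1 / m) * (k * sinh (m * x) - (sinh (m * x) * P x - cosh (m * x) * R x))" for x
  define z where "z x = k * cosh (m * x) - (cosh (m * x) * P x - sinh (m * x) * R x)" for x
  have i1: "(\<lambda>y. a_h h y * (cosh (m * y) * c y)) integrable_on {0..1}"
    using c by (intro a_h_mult_integrable') (auto intro!: continuous_intros)
  have i2: "(\<lambda>y. a_h h y * (sinh (m * y) * c y)) integrable_on {0..1}"
    using c by (intro a_h_mult_integrable') (auto intro!: continuous_intros)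
  have cP: "continuous_on {0..1} P"
    unfolding P_def using i1 by (rule indefinite_integral_continuous_1)
  have cR: "continuous_on {0..1} R"
    unfolding R_def using i2 by (rule indefinite_integral_continuous_1)
  have cw: "continuous_on {0..1} w" and cz: "continuous_on {0..1} z"
    unfolding w_def z_def by (intro continuous_intros cP cR)+
  have cc: "isCont c x" if "x \<in> {0<..<1}" for x
    using that c by (metis continuous_on_interior interior_atLeastAtMost_real)
  have dP: "(P has_real_derivative a_h h x * (cosh (m * x) * c x)) (at x)" 
    and dR: "(R has_real_derivative a_h h x * (sinh (m * x) * c x)) (at x)"
    if x: "x \<in> {0<..<1} - ?S" for x
  proof -
    have "isCont (a_h h) x" "isCont c x"
      using x h_pos by (auto intro: a_h_isCont cc)
    moreover have "isCont (\<lambda>y. cosh (m * y)) x" "isCont (\<lambda>y. sinh (m * y)) x"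
      by (intro continuous_intros)+
    ultimately have "isCont (\<lambda>y. a_h h y * (cosh (m * y) * c y)) x"
        "isCont (\<lambda>y. a_h h y * (sinh (m * y) * c y)) x"
      by (auto intro: isCont_mult)
    then show "(P has_real_derivative a_h h x * (cosh (m * x) * c x)) (at x)"
      "(R has_real_derivative a_h h x * (sinh (m * x) * c x)) (at x)"
      unfolding P_def R_def using x
      by (intro indefinite_integral_has_real_derivative[OF i1]
          indefinite_integral_has_real_derivative[OF i2]; simp)+
  qed
  have dw: "(w has_real_derivative z x) (at x)"
    and dz: "(z has_real_derivative (m\<^sup>2 * w x - a_h h x * c x)) (at x)"
    if x: "x \<in> {0<..<1} - ?S" for x
  proof -
    let ?s = "sinh (m * x)" and ?t = "cosh (m * x)" and ?a = "a_h h x * c x"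
    have s': "((\<lambda>x. sinh (m * x)) has_real_derivative ?t * m) (at x)"
      and t': "((\<lambda>x. cosh (m * x)) has_real_derivative ?s * m) (at x)"
      by (auto intro!: derivative_eq_intros)
    have P': "(P has_real_derivative ?t * ?a) (at x)" and R': "(R has_real_derivative ?s * ?a) (at x)"
      using dP[OF x] dR[OF x] by (simp_all add: mult.left_commute)
    have "(w has_real_derivative (1 / m) * (k * (?t * m) - ((?t * m * P x + ?t * ?a * ?s)
        - (?s * m * R x + ?s * ?a * ?t)))) (at x)"
      unfolding w_def by (intro DERIV_cmult DERIV_diff DERIV_mult s' t' P' R')
    then show "(w has_real_derivative z x) (at x)"
      by (rule DERIV_cong) (use m_pos in \<open>simp add: z_def field_simps\<close>)
    have *: "(z has_real_derivative k * (?s * m) - ((?s * m * P x + ?t * ?a * ?t)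
        - (?t * m * R x + ?s * ?a * ?s))) (at x)"
      unfolding z_def by (intro DERIV_cmult DERIV_diff DERIV_mult s' t' P' R')
    have "m\<^sup>2 * w x = m * (k * ?s - (?s * P x - ?t * R x))"
      unfolding w_def using m_pos by (simp add: power2_eq_square)
    \<comment> \<open>By \<open>cosh\<^sup>2 - sinh\<^sup>2 = 1\<close>, the derivatives of
      \<open>P\<close> and \<open>R\<close> leave exactly one copy of the source term.\<close>
    moreover have "?a * ?t\<^sup>2 = ?a * ?s\<^sup>2 + ?a"
      by (simp only: cosh_square_eq distrib_left mult_1_right)
    ultimately show "(z has_real_derivative (m\<^sup>2 * w x - a_h h x * c x)) (at x)"
      by (intro DERIV_cong[OF *]) (simp add: power2_eq_square algebra_simps)
  qed
  have "w 0 = 0"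
    by (simp add: w_def R_def)
  moreover have "w 1 = 0"
    using m_pos by (simp add: w_def k_def)
  moreover have "(w has_real_derivative z x) (at x within {0..1})" if "x \<in> {0..1}" for x
    by (rule has_real_derivative_continuous_extension[where S = ?S, OF _ cw cz dw that]) auto
  ultimately have "dirichlet c w z"
    unfolding dirichlet_def using cz dz by simp
  then show ?thesis by (rule that)
qed

section \<open>Admissible functions: pointwise bounds, scaling, and testing against the linear
  problem\<close>

lemma continuous_on_pos_powr:
  assumes "continuous_on S u" "0 < q"
  shows "continuous_on S (\<lambda>x. max 0 (u x :: real) powr q)"
  using assms by (intro continuous_on_powr' continuous_intros) auto

lemma mass_integrable:
  "continuous_on {0..1} u \<Longrightarrow> (\<lambda>x. a_h h x * max 0 (u x) powr (p + 1)) integrable_on {0..1}"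
  using p_gt_1 by (intro a_h_mult_integrable' continuous_on_pos_powr) auto

lemma admissible_continuous: "admissible u g \<Longrightarrow> continuous_on {0..1} u"
  by (simp add: admissible_def)

lemma admissible_integrable:
  assumes "admissible u g"
  shows "(\<lambda>x. (g x)\<^sup>2 + m\<^sup>2 * (u x)\<^sup>2) integrable_on {0..1}"
proof (rule integrable_add)
  show "(\<lambda>x. m\<^sup>2 * (u x)\<^sup>2) integrable_on {0..1}"
    by (intro integrable_continuous_real continuous_intros admissible_continuous[OF assms])
qed (use assms in \<open>simp add: admissible_def\<close>)

lemma energy_nonneg: "admissible u g \<Longrightarrow> 0 \<le> energy u g"
  unfolding energy_def by (intro integral_nonneg admissible_integrable) auto

lemma admissible_has_integral:
  assumes "admissible u g" "0 \<le> x" "x \<le> y" "y \<le> 1"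
  shows "(g has_integral (u y - u x)) {x..y}"
proof -
  obtain S where S: "finite S" "\<And>x. x \<in> {0<..<1} - S \<Longrightarrow> (u has_real_derivative g x) (at x)"
    using assms(1) unfolding admissible_def by blast
  have "continuous_on {x..y} u"
    using assms by (auto intro: continuous_on_subset[OF admissible_continuous])
  then show ?thesis
    using assms(2-4) S
    by (intro fundamental_theorem_of_calculus_interior_strong[of S])
      (auto simp flip: has_real_derivative_iff_has_vector_derivative)
qed

text \<open>A linearised Cauchy-Schwarz inequality: integrate
  \<open>\<bar>g\<bar> \<le> t / 2 * g\<^sup>2 + 1 / (2 * t)\<close>. The free parameter
  \<open>t\<close> is tuned once for the sup bound and once for equicontinuity.\<close>

lemma admissible_osc:
  assumes adm: "admissible u g" and xy: "0 \<le> x" "x \<le> y" "y \<le> 1" and t: "0 < t"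
  shows "\<bar>u y - u x\<bar> \<le> t / 2 * energy u g + (y - x) / (2 * t)"
proof -
  let ?e = "\<lambda>x. (g x)\<^sup>2 + m\<^sup>2 * (u x)\<^sup>2"
  let ?I = "integral {x..y} ?e"
  have int: "?e integrable_on {x..y}"
    using xy by (intro integrable_on_subinterval[OF admissible_integrable[OF adm]]) auto
  have "((\<lambda>s. t / 2 * ?e s) has_integral t / 2 * ?I) {x..y}"
    using int by (intro has_integral_mult_right integrable_integral)
  moreover have "((\<lambda>s. 1 / (2 * t)) has_integral (y - x) * (1 / (2 * t))) {x..y}"
    using has_integral_const_real[of "1 / (2 * t)" x y] xy by simp
  ultimately have bound: "((\<lambda>s. t / 2 * ?e s + 1 / (2 * t)) has_integral
      t / 2 * ?I + (y - x) * (1 / (2 * t))) {x..y}"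
    by (rule has_integral_add)
  have pw: "\<bar>g s\<bar> \<le> t / 2 * ?e s + 1 / (2 * t)" for s
  proof -
    have "0 \<le> (t * \<bar>g s\<bar> - 1)\<^sup>2 / (2 * t)"
      using t by simp
    also have "\<dots> = t / 2 * (g s)\<^sup>2 - \<bar>g s\<bar> + 1 / (2 * t)"
      using t by (simp add: power2_eq_square field_simps)
    finally have "\<bar>g s\<bar> \<le> t / 2 * (g s)\<^sup>2 + 1 / (2 * t)"
      by simp
    moreover have "0 \<le> t / 2 * (m\<^sup>2 * (u s)\<^sup>2)"
      using t by simp
    ultimately show ?thesis
      by (simp add: distrib_left)
  qed
  have hi: "(g has_integral (u y - u x)) {x..y}"
    using adm xy by (rule admissible_has_integral)
  have "u y - u x \<le> t / 2 * ?I + (y - x) * (1 / (2 * t))"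
    by (rule has_integral_le[OF hi bound]) (use pw in \<open>smt (verit)\<close>)
  moreover have "- (u y - u x) \<le> t / 2 * ?I + (y - x) * (1 / (2 * t))"
    by (rule has_integral_le[OF has_integral_neg[OF hi] bound]) (use pw in \<open>smt (verit)\<close>)
  moreover have "?I \<le> energy u g"
    unfolding energy_def
    using xy by (intro integral_subset_le int admissible_integrable[OF adm]) auto
  then have "t / 2 * ?I \<le> t / 2 * energy u g"
    using t by (intro mult_left_mono) auto
  ultimately show ?thesis
    by (simp add: abs_le_iff)
qed

text \<open>Taking \<open>t = 1 / \<bar>u x\<bar>\<close> in the oscillation bound on
  \<open>[0, x]\<close>, where \<open>u 0 = 0\<close> and \<open>x \<le> 1\<close>, gives
  \<open>\<bar>u x\<bar> \<le> energy u g / (2 * \<bar>u x\<bar>) + \<bar>u x\<bar> /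
  2\<close>.\<close>

lemma admissible_sup:
  assumes adm: "admissible u g" and x: "x \<in> {0..1}"
  shows "(u x)\<^sup>2 \<le> energy u g"
proof (cases "u x = 0")
  case False
  let ?A = "\<bar>u x\<bar>"
  have "\<bar>u x - u 0\<bar> \<le> 1 / ?A / 2 * energy u g + (x - 0) / (2 * (1 / ?A))"
    using False x by (intro admissible_osc[OF adm]) auto
  moreover have "u 0 = 0"
    using adm by (simp add: admissible_def)
  moreover have "x * ?A \<le> ?A"
    using x by (intro mult_left_le_one_le) auto
  ultimately have "?A \<le> energy u g / (2 * ?A) + ?A / 2"
    by simp
  then have "?A / 2 * (2 * ?A) \<le> energy u g / (2 * ?A) * (2 * ?A)"
    by (intro mult_right_mono) auto
  then show ?thesis
    using False by (simp add: power2_eq_square)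
qed (use energy_nonneg[OF adm] in simp)

lemma admissible_scale:
  assumes "admissible u g"
  shows "admissible (\<lambda>x. s * u x) (\<lambda>x. s * g x)"
    and "energy (\<lambda>x. s * u x) (\<lambda>x. s * g x) = s\<^sup>2 * energy u g"
proof -
  obtain S where S: "finite S" "\<And>x. x \<in> {0<..<1} - S \<Longrightarrow> (u has_real_derivative g x) (at x)"
    using assms unfolding admissible_def by blast
  have "(\<lambda>x. s\<^sup>2 * (g x)\<^sup>2) integrable_on {0..1}"
    using assms unfolding admissible_def by (intro integrable_on_mult_right) auto
  moreover have "continuous_on {0..1} (\<lambda>x. s * u x)"
    by (intro continuous_intros admissible_continuous[OF assms])
  moreover have "\<exists>S. finite S \<and> (\<forall>x\<in>{0<..<1} - S. ((\<lambda>x. s * u x) has_real_derivative s * g x) (at x))"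
    using S by (intro exI[of _ S]) (auto intro!: DERIV_cmult)
  ultimately show "admissible (\<lambda>x. s * u x) (\<lambda>x. s * g x)"
    using assms unfolding admissible_def by (simp add: power_mult_distrib)
  show "energy (\<lambda>x. s * u x) (\<lambda>x. s * g x) = s\<^sup>2 * energy u g"
    unfolding energy_def integral_mult_right[symmetric]
    by (simp add: power_mult_distrib algebra_simps)
qed

lemma mass_scale:
  assumes "0 < s"
  shows "mass (\<lambda>x. s * u x) = s powr (p + 1) * mass u"
proof -
  have "max 0 (s * u x) = s * max 0 (u x)" for x
    using assms by (simp add: max_def mult_le_0_iff zero_le_mult_iff)
  then show ?thesis
    unfolding mass_def integral_mult_right[symmetric]
    using assms by (simp add: powr_mult mult_ac)
qed

text \<open>Weak form of the linear problem: the product \<open>v * z\<close> vanishes at both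
  endpoints, so its derivative integrates to zero, and \<open>z'\<close> is replaced by means of the
  equation.\<close>

lemma dirichlet_pairing:
  assumes v: "admissible v k" and w: "dirichlet c w z" and c: "continuous_on {0..1} c"
  shows "((\<lambda>x. k x * z x + m\<^sup>2 * (v x * w x)) has_integral
    integral {0..1} (\<lambda>x. a_h h x * (c x * v x))) {0..1}"
proof -
  let ?S = "{(1 - h) / 2, (1 + h) / 2}"
  obtain S where S: "finite S" "\<And>x. x \<in> {0<..<1} - S \<Longrightarrow> (v has_real_derivative k x) (at x)"
    using v unfolding admissible_def by blast
  have cv: "continuous_on {0..1} v" "v 0 = 0" "v 1 = 0"
    using v by (auto simp: admissible_def)
  have z: "continuous_on {0..1} z"
    using w by (simp add: dirichlet_def)
  have "((\<lambda>x. k x * z x + (m\<^sup>2 * w x - a_h h x * c x) * v x) has_integral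
      (v 1 * z 1 - v 0 * z 0)) {0..1}"
  proof (rule fundamental_theorem_of_calculus_interior_strong[of "S \<union> ?S"])
    fix x assume x: "x \<in> {0<..<1} - (S \<union> ?S)"
    have "((\<lambda>x. v x * z x) has_real_derivative k x * z x + (m\<^sup>2 * w x - a_h h x * c x) * v x) (at x)"
      using w x S(2)[of x] unfolding dirichlet_def by (intro DERIV_mult) auto
    then show "((\<lambda>x. v x * z x) has_vector_derivative
        k x * z x + (m\<^sup>2 * w x - a_h h x * c x) * v x) (at x)"
      by (simp add: has_real_derivative_iff_has_vector_derivative)
  qed (use S(1) cv z in \<open>auto intro!: continuous_intros\<close>)
  moreover have "((\<lambda>x. a_h h x * (c x * v x)) has_integral
      integral {0..1} (\<lambda>x. a_h h x * (c x * v x))) {0..1}"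
    using c cv by (intro integrable_integral a_h_mult_integrable' continuous_intros)
  ultimately have "((\<lambda>x. (k x * z x + (m\<^sup>2 * w x - a_h h x * c x) * v x) + a_h h x * (c x * v x))
      has_integral (v 1 * z 1 - v 0 * z 0) + integral {0..1} (\<lambda>x. a_h h x * (c x * v x))) {0..1}"
    by (rule has_integral_add)
  then show ?thesis
    using cv by (simp add: algebra_simps)
qed

lemma dirichlet_admissible:
  assumes "dirichlet c w z"
  shows "admissible w z"
proof -
  have "continuous_on {0..1} z"
    using assms by (simp add: dirichlet_def)
  then have "(\<lambda>x. (z x)\<^sup>2) integrable_on {0..1}"
    by (intro integrable_continuous_real continuous_intros)
  then show ?thesis
    using assms dirichlet_continuous[OF assms] dirichlet_DERIV[OF assms]
    unfolding admissible_def by (auto simp: dirichlet_def intro!: exI[of _ "{}"])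
qed

lemma dirichlet_energy:
  assumes "dirichlet c w z" "continuous_on {0..1} c"
  shows "energy w z = integral {0..1} (\<lambda>x. a_h h x * (c x * w x))"
  using dirichlet_pairing[OF dirichlet_admissible[OF assms(1)] assms]
  by (simp add: energy_def power2_eq_square integral_unique)

text \<open>In the expanded square the cross term is the pairing with \<open>w\<close>. It thus
  becomes an integral of \<open>u\<close> without its derivative, which passes to uniform
  limits.\<close>

lemma energy_minus_dirichlet:
  assumes u: "admissible u g" and w: "dirichlet c w z" and c: "continuous_on {0..1} c"
  shows "admissible (\<lambda>x. u x - s * w x) (\<lambda>x. g x - s * z x)" (is ?A)
    and "energy (\<lambda>x. u x - s * w x) (\<lambda>x. g x - s * z x) =
      energy u g - 2 * s * integral {0..1} (\<lambda>x. a_h h x * (c x * u x)) + s\<^sup>2 * energy w z" (is ?B)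
proof -
  let ?I = "integral {0..1} (\<lambda>x. a_h h x * (c x * u x))"
  have w': "admissible w z"
    using w by (rule dirichlet_admissible)
  have "((\<lambda>x. (g x)\<^sup>2 + m\<^sup>2 * (u x)\<^sup>2) has_integral energy u g) {0..1}"
    unfolding energy_def using admissible_integrable[OF u] by (rule integrable_integral)
  moreover have "((\<lambda>x. 2 * s * (g x * z x + m\<^sup>2 * (u x * w x))) has_integral 2 * s * ?I) {0..1}"
    using dirichlet_pairing[OF u w c] by (rule has_integral_mult_right)
  moreover have "((\<lambda>x. s\<^sup>2 * ((z x)\<^sup>2 + m\<^sup>2 * (w x)\<^sup>2)) has_integral s\<^sup>2 * energy w z) {0..1}"
    unfolding energy_def
    by (intro has_integral_mult_right integrable_integral admissible_integrable w')
  ultimately have "((\<lambda>x. ((g x)\<^sup>2 + m\<^sup>2 * (u x)\<^sup>2) - 2 * s * (g x * z x + m\<^sup>2 * (u x * w x)) +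
      s\<^sup>2 * ((z x)\<^sup>2 + m\<^sup>2 * (w x)\<^sup>2)) has_integral energy u g - 2 * s * ?I + s\<^sup>2 * energy w z) {0..1}"
    by (intro has_integral_add has_integral_diff)
  moreover have "(\<lambda>x. ((g x)\<^sup>2 + m\<^sup>2 * (u x)\<^sup>2) - 2 * s * (g x * z x + m\<^sup>2 * (u x * w x)) +
      s\<^sup>2 * ((z x)\<^sup>2 + m\<^sup>2 * (w x)\<^sup>2)) = (\<lambda>x. (g x - s * z x)\<^sup>2 + m\<^sup>2 * (u x - s * w x)\<^sup>2)"
    by (simp add: fun_eq_iff power2_eq_square algebra_simps)
  ultimately have int: "((\<lambda>x. (g x - s * z x)\<^sup>2 + m\<^sup>2 * (u x - s * w x)\<^sup>2) has_integral
      energy u g - 2 * s * ?I + s\<^sup>2 * energy w z) {0..1}"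
    by simp
  then show ?B
    by (simp add: energy_def integral_unique)
  have cont: "continuous_on {0..1} (\<lambda>x. u x - s * w x)"
    by (intro continuous_intros admissible_continuous[OF u] admissible_continuous[OF w'])
  then have "(\<lambda>x. m\<^sup>2 * (u x - s * w x)\<^sup>2) integrable_on {0..1}"
    by (intro integrable_continuous_real continuous_on_mult continuous_on_const continuous_on_power)
  \<comment> \<open>Square integrability of the new derivative is recovered by removing the
    continuous term from the integrable energy density.\<close>
  then have "(\<lambda>x. ((g x - s * z x)\<^sup>2 + m\<^sup>2 * (u x - s * w x)\<^sup>2) - m\<^sup>2 * (u x - s * w x)\<^sup>2) integrable_on {0..1}"
    using int by (intro integrable_diff) blast+
  then have "(\<lambda>x. (g x - s * z x)\<^sup>2) integrable_on {0..1}"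
    by simp
  moreover obtain S where S: "finite S" "\<And>x. x \<in> {0<..<1} - S \<Longrightarrow> (u has_real_derivative g x) (at x)"
    using u unfolding admissible_def by blast
  then have "\<exists>S. finite S \<and> (\<forall>x\<in>{0<..<1} - S.
      ((\<lambda>x. u x - s * w x) has_real_derivative g x - s * z x) (at x))"
    using dirichlet_DERIV[OF w] by (intro exI[of _ S]) (auto intro!: DERIV_diff DERIV_cmult)
  ultimately show ?A
    using u w' cont unfolding admissible_def by simp
qed

section \<open>The supremum of the mass: finiteness, attainment, and positivity of the
  maximiser\<close>

lemma mass_le_1:
  assumes "admissible u g" "energy u g \<le> 1"
  shows "mass u \<le> 1"
proof -
  have "mass u \<le> integral {0..1} (\<lambda>x::real. 1::real)"
    unfolding mass_def
  proof (rule integral_le)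
    fix x :: real assume "x \<in> {0..1}"
    then have "(u x)\<^sup>2 \<le> 1"
      using admissible_sup[OF assms(1)] assms(2) by fastforce
    then have "max 0 (u x) \<le> 1"
      using abs_square_le_1[of "u x"] by simp
    then have "max 0 (u x) powr (p + 1) \<le> 1"
      using p_gt_1 by (intro powr_le1) auto
    then show "a_h h x * max 0 (u x) powr (p + 1) \<le> 1"
      using a_h_bounds by (intro mult_le_one) auto
  qed (use mass_integrable admissible_continuous assms in auto)
  then show ?thesis by simp
qed

text \<open>This makes the supremum positive, so that dividing by it makes sense. A parabola has
  positive mass to the left of the gap, and a small multiple of it meets the energy
  constraint.\<close>

lemma admissible_mass_pos_exists: "\<exists>u g. admissible u g \<and> energy u g \<le> 1 \<and> 0 < mass u"
proof -
  define u :: "real \<Rightarrow> real" where "u x = x * (1 - x)" for x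
  define g :: "real \<Rightarrow> real" where "g x = 1 - 2 * x" for x
  let ?r = "(1 - h) / 2"
  have "(u has_real_derivative g x) (at x)" for x
    unfolding u_def g_def by (auto intro!: derivative_eq_intros)
  moreover have cu: "continuous_on {0..1} u" and "continuous_on {0..1} g"
    unfolding u_def g_def by (auto intro!: continuous_intros)
  then have "(\<lambda>x. (g x)\<^sup>2) integrable_on {0..1}"
    by (intro integrable_continuous_real continuous_intros)
  ultimately have adm: "admissible u g"
    using cu unfolding admissible_def by (auto simp: u_def)
  \<comment> \<open>On \<open>[?r / 2, ?r]\<close> the weight is 1, and
    \<open>x \<ge> ?r / 2\<close> together with \<open>1 - x \<ge> 1 / 2\<close> gives
    \<open>u x \<ge> ?r / 4\<close>.\<close>
  have "0 < ?r / 2 * (?r / 4) powr (p + 1)"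
    using h_lt_1 by simp
  also have "\<dots> = integral {?r / 2..?r} (\<lambda>x. (?r / 4) powr (p + 1))"
    using h_lt_1 by simp
  also have "\<dots> \<le> integral {?r / 2..?r} (\<lambda>x. a_h h x * max 0 (u x) powr (p + 1))"
  proof (rule integral_le)
    fix x assume x: "x \<in> {?r / 2..?r}"
    have "?r / 2 * (1 / 2) \<le> x * (1 - x)"
      using x h_pos h_lt_1 by (intro mult_mono) auto
    then have "?r / 4 \<le> u x"
      by (simp add: u_def)
    moreover have "a_h h x = 1"
      using x by (simp add: a_h_def)
    ultimately show "(?r / 4) powr (p + 1) \<le> a_h h x * max 0 (u x) powr (p + 1)"
      using h_lt_1 p_gt_1 by (auto intro!: powr_mono2)
  next
    show "(\<lambda>x. a_h h x * max 0 (u x) powr (p + 1)) integrable_on {?r / 2..?r}"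
      using h_pos h_lt_1 by (intro integrable_on_subinterval[OF mass_integrable[OF cu]]) auto
  qed auto
  also have "\<dots> \<le> mass u"
    unfolding mass_def using h_pos h_lt_1 mass_integrable[OF cu]
    by (intro integral_subset_le integrable_on_subinterval[OF mass_integrable[OF cu]])
      (auto simp: a_h_bounds)
  finally have "0 < mass u" .
  let ?E = "energy u g"
  \<comment> \<open>Adding 1 keeps the root positive, and the scaled energy is
    \<open>?E / (?E + 1)\<close>.\<close>
  define s where "s = 1 / sqrt (?E + 1)"
  have E: "0 \<le> ?E"
    using adm by (rule energy_nonneg)
  then have "0 < s" "s\<^sup>2 * ?E \<le> 1"
    by (auto simp: s_def power_divide)
  then have "energy (\<lambda>x. s * u x) (\<lambda>x. s * g x) \<le> 1" "0 < mass (\<lambda>x. s * u x)"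
    using \<open>0 < mass u\<close> admissible_scale(2)[OF adm] by (auto simp: mass_scale)
  then show ?thesis
    using admissible_scale(1)[OF adm] by blast
qed

lemma young_powr:
  assumes "0 \<le> X" "0 \<le> Y"
  shows "X powr p * Y \<le> p / (p + 1) * X powr (p + 1) + 1 / (p + 1) * Y powr (p + 1)"
proof -
  have "X powr p * Y \<le> (X powr p) powr ((p + 1) / p) / ((p + 1) / p) + Y powr (p + 1) / (p + 1)"
    using p_gt_1 assms by (intro Youngs_inequality) (auto simp: field_simps)
  then show ?thesis
    using p_gt_1 by (simp add: powr_powr mult.commute)
qed

text \<open>Let \<open>s\<close> be the root of the energy of \<open>w\<close>, and test with the
  normalised function \<open>w / s\<close>. Then \<open>s\<close> is the weighted integral of
  \<open>max 0 u powr p * (w / s)\<close>, and Young's inequality splits it into the masses of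
  \<open>u\<close> and \<open>w / s\<close>. Each is at most \<open>C\<close>, and the coefficients
  \<open>p / (p + 1)\<close> and \<open>1 / (p + 1)\<close> add up to 1, so
  \<open>s \<le> C\<close>.\<close>

lemma dirichlet_energy_bound:
  assumes C: "\<And>v k. admissible v k \<Longrightarrow> energy v k \<le> 1 \<Longrightarrow> mass v \<le> C"
    and u: "continuous_on {0..1} u" "mass u \<le> C" "0 \<le> C"
    and w: "dirichlet (\<lambda>x. max 0 (u x) powr p) w z"
  shows "energy w z \<le> C\<^sup>2"
proof (cases "energy w z = 0")
  case False
  define s where "s = sqrt (energy w z)"
  have w': "admissible w z"
    using w by (rule dirichlet_admissible)
  then have s: "0 < s" "s\<^sup>2 = energy w z"
    using False energy_nonneg[OF w'] by (auto simp: s_def)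
  have c: "continuous_on {0..1} (\<lambda>x. max 0 (u x) powr p)"
    using u(1) p_gt_1 by (intro continuous_on_pos_powr) auto
  let ?y = "\<lambda>x. (1 / s) * w x"
  have y: "admissible ?y (\<lambda>x. (1 / s) * z x)" "energy ?y (\<lambda>x. (1 / s) * z x) = 1"
    using admissible_scale[OF w', of "1 / s"] s by (auto simp: power_divide)
  have "s = (1 / s) * energy w z"
    using s by (simp add: power2_eq_square flip: s(2))
  also have "\<dots> = integral {0..1} (\<lambda>x. (1 / s) * (a_h h x * (max 0 (u x) powr p * w x)))"
    unfolding dirichlet_energy[OF w c] by simp
  also have "\<dots> \<le> integral {0..1} (\<lambda>x. p / (p + 1) * (a_h h x * max 0 (u x) powr (p + 1)) +
      1 / (p + 1) * (a_h h x * max 0 (?y x) powr (p + 1)))"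
  proof (rule integral_le)
    show "(\<lambda>x. (1 / s) * (a_h h x * (max 0 (u x) powr p * w x))) integrable_on {0..1}"
      by (intro integrable_on_mult_right a_h_mult_integrable' continuous_on_mult c
          dirichlet_continuous[OF w])
    show "(\<lambda>x. p / (p + 1) * (a_h h x * max 0 (u x) powr (p + 1)) +
        1 / (p + 1) * (a_h h x * max 0 (?y x) powr (p + 1))) integrable_on {0..1}"
      by (intro integrable_add integrable_on_mult_right mass_integrable u
          admissible_continuous[OF y(1)])
    fix x :: real
    \<comment> \<open>\<open>?y\<close> may change sign; dropping its negative part only increases
      the product.\<close>
    have "max 0 (u x) powr p * ?y x \<le> max 0 (u x) powr p * max 0 (?y x)"
      by (intro mult_left_mono) auto
    also have "\<dots> \<le> p / (p + 1) * max 0 (u x) powr (p + 1) + 1 / (p + 1) * max 0 (?y x) powr (p + 1)"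
      by (rule young_powr) auto
    finally have "a_h h x * (max 0 (u x) powr p * ?y x) \<le>
        a_h h x * (p / (p + 1) * max 0 (u x) powr (p + 1) + 1 / (p + 1) * max 0 (?y x) powr (p + 1))"
      by (intro mult_left_mono a_h_bounds)
    then show "(1 / s) * (a_h h x * (max 0 (u x) powr p * w x)) \<le>
        p / (p + 1) * (a_h h x * max 0 (u x) powr (p + 1)) +
        1 / (p + 1) * (a_h h x * max 0 (?y x) powr (p + 1))"
      by (simp add: algebra_simps)
  qed
  also have "\<dots> = p / (p + 1) * mass u + 1 / (p + 1) * mass ?y"
    unfolding mass_def integral_mult_right[symmetric]
    by (intro integral_add integrable_on_mult_right mass_integrable u admissible_continuous[OF y(1)])
  also have "\<dots> \<le> p / (p + 1) * C + 1 / (p + 1) * C"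
    using p_gt_1 u(2) C[OF y(1)] y(2) by (intro add_mono mult_left_mono) auto
  also have "\<dots> = (p / (p + 1) + 1 / (p + 1)) * C"
    by (simp only: distrib_right)
  also have "p / (p + 1) + 1 / (p + 1) = 1"
    using p_gt_1 by (simp flip: add_divide_distrib)
  finally have "s \<le> C"
    by simp
  then have "s\<^sup>2 \<le> C\<^sup>2"
    using s(1) by (intro power_mono) auto
  then show ?thesis
    using s(2) by simp
qed simp

lemma dirichlet_scale:
  assumes "dirichlet c w z" "\<And>x. x \<in> {0<..<1} \<Longrightarrow> d x = s * c x"
  shows "dirichlet d (\<lambda>x. s * w x) (\<lambda>x. s * z x)"
  unfolding dirichlet_def
proof (intro conjI ballI)
  show "continuous_on {0..1} (\<lambda>x. s * z x)"
    using assms(1) unfolding dirichlet_def by (intro continuous_intros) auto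
  fix x assume "x \<in> {0<..<1} - {(1 - h) / 2, (1 + h) / 2}"
  then have "((\<lambda>x. s * z x) has_real_derivative s * (m\<^sup>2 * w x - a_h h x * c x)) (at x)" "d x = s * c x"
    using assms unfolding dirichlet_def by (auto intro!: DERIV_cmult)
  then show "((\<lambda>x. s * z x) has_real_derivative m\<^sup>2 * (s * w x) - a_h h x * d x) (at x)"
    by (simp add: algebra_simps)
qed (use assms(1) in \<open>auto simp: dirichlet_def intro!: DERIV_cmult\<close>)

text \<open>The Dirichlet clause is the Euler-Lagrange equation with multiplier
  \<open>1 / C\<close>. Compactness comes from Arzela-Ascoli, since the energy constraint bounds a
  maximising sequence and makes it equicontinuous.\<close>

lemma maximiser_exists:
  obtains C u z where "0 < C" "\<And>v k. admissible v k \<Longrightarrow> energy v k \<le> 1 \<Longrightarrow> mass v \<le> C"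
    "mass u = C" "energy u z \<le> 1" "dirichlet (\<lambda>x. max 0 (u x) powr p / C) u z"
proof -
  define M where "M = {mass u |u g. admissible u g \<and> energy u g \<le> 1}"
  define C where "C = Sup M"
  have M: "bdd_above M"
    unfolding M_def using mass_le_1 by (intro bdd_aboveI[of _ 1]) auto
  have C: "mass v \<le> C" if "admissible v k" "energy v k \<le> 1" for v k
    unfolding C_def using that by (intro cSup_upper M) (auto simp: M_def)
  have ne: "M \<noteq> {}" and C_pos: "0 < C"
    using admissible_mass_pos_exists C by (force simp: M_def)+
  have "\<exists>u g. admissible u g \<and> energy u g \<le> 1 \<and> C - inverse (real (Suc n)) < mass u" for n
  proof -
    have "C - inverse (real (Suc n)) < Sup M"
      by (simp add: C_def)
    then show ?thesis
      using less_cSup_iff[OF ne M] by (auto simp: M_def)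
  qed
  then obtain U G where U: "\<And>n. admissible (U n) (G n)" "\<And>n. energy (U n) (G n) \<le> 1"
    "\<And>n. C - inverse (real (Suc n)) < mass (U n)"
    by metis
  have U_sup: "\<bar>U n x\<bar> \<le> 1" if "x \<in> {0..1}" for n x
    using admissible_sup[OF U(1) that, of n] U(2)[of n] abs_square_le_1[of "U n x"] by linarith
  \<comment> \<open>With \<open>t = e\<close> in the oscillation bound, the energy contributes at
    most \<open>e / 2\<close> and the length of the interval less than \<open>e / 2\<close>.\<close>
  have U_osc: "\<bar>U n y - U n x\<bar> < e" if "0 < e" "0 \<le> x" "x \<le> y" "y \<le> 1" "y - x < e\<^sup>2" for n x y e
  proof -
    have "\<bar>U n y - U n x\<bar> \<le> e / 2 * energy (U n) (G n) + (y - x) / (2 * e)"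
      using that by (intro admissible_osc U) auto
    also have "\<dots> < e / 2 * 1 + e\<^sup>2 / (2 * e)"
      using that U(2) by (intro add_le_less_mono mult_left_mono divide_strict_right_mono) auto
    also have "\<dots> = e"
      using that by (simp add: power2_eq_square)
    finally show ?thesis .
  qed
  have U_equi: "\<exists>d>0. \<forall>n y. y \<in> {0..1} \<and> norm (x - y) < d \<longrightarrow> norm (U n x - U n y) < e"
    if "x \<in> {0..1}" "0 < e" for x e
  proof (intro exI[of _ "e\<^sup>2"] conjI allI impI)
    fix n y assume "y \<in> {0..1} \<and> norm (x - y) < e\<^sup>2"
    then show "norm (U n x - U n y) < e"
      using U_osc[of e x y n] U_osc[of e y x n] that by (cases "x \<le> y") auto
  qed (use that in simp)
  have "norm (U n x) \<le> 1" if "x \<in> {0..1}" for n x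
    using U_sup[OF that] by simp
  then obtain f r where f: "continuous_on {0..1} f" "strict_mono (r :: nat \<Rightarrow> nat)"
    and unif: "\<And>e. 0 < e \<Longrightarrow> \<exists>N. \<forall>n x. N \<le> n \<and> x \<in> {0..1} \<longrightarrow> norm (U (r n) x - f x) < e"
    using Arzela_Ascoli[OF compact_Icc _ U_equi] by blast
  have lim: "(\<lambda>n. U (r n) x) \<longlonglongrightarrow> f x" if "x \<in> {0..1}" for x
    unfolding LIMSEQ_iff using unif that by meson
  have U_cont: "continuous_on {0..1} (U n)" for n
    by (rule admissible_continuous[OF U(1)])
  have "(\<lambda>n. mass (U (r n))) \<longlonglongrightarrow> mass f"
    unfolding mass_def
  proof (rule dominated_convergence(2))
    show "(\<lambda>x::real. 1::real) integrable_on {0..1}"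
      by (intro integrable_continuous_real continuous_intros)
    fix x :: real assume x: "x \<in> {0..1}"
    show "(\<lambda>n. a_h h x * max 0 (U (r n) x) powr (p + 1)) \<longlonglongrightarrow> a_h h x * max 0 (f x) powr (p + 1)"
      using p_gt_1 by (intro tendsto_mult tendsto_const tendsto_powr' tendsto_max lim x) auto
    fix n
    have "max 0 (U (r n) x) powr (p + 1) \<le> 1"
      using U_sup[OF x, of "r n"] p_gt_1 by (intro powr_le1) auto
    then show "norm (a_h h x * max 0 (U (r n) x) powr (p + 1)) \<le> 1"
      using a_h_bounds by (auto intro!: mult_le_one simp: abs_mult)
  qed (intro mass_integrable U_cont)
  moreover have "(\<lambda>n. mass (U (r n))) \<longlonglongrightarrow> C"
  proof (rule tendsto_sandwich)
    have "(\<lambda>n. C - inverse (real (Suc n))) \<longlonglongrightarrow> C - 0"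
      by (intro tendsto_diff tendsto_const LIMSEQ_inverse_real_of_nat)
    then show "(\<lambda>n. C - inverse (real (Suc (r n)))) \<longlonglongrightarrow> C"
      using LIMSEQ_subseq_LIMSEQ[OF _ f(2), of "\<lambda>n. C - inverse (real (Suc n))" C]
      by (simp add: o_def)
    show "\<forall>\<^sub>F n in sequentially. C - inverse (real (Suc (r n))) \<le> mass (U (r n))"
      using U(3) by (intro always_eventually allI less_imp_le)
    show "\<forall>\<^sub>F n in sequentially. mass (U (r n)) \<le> C"
      by (intro always_eventually allI C[OF U(1,2)])
  qed simp
  ultimately have mass_f: "mass f = C"
    by (rule LIMSEQ_unique)
  let ?c = "\<lambda>x. max 0 (f x) powr p"
  have c: "continuous_on {0..1} ?c"
    using f(1) p_gt_1 by (intro continuous_on_pos_powr) auto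
  obtain w z where w: "dirichlet ?c w z"
    using dirichlet_exists[OF c] .
  \<comment> \<open>The energy of \<open>U (r n) - s * w\<close> is bounded by
    \<open>1 - 2 * s * ?I n + s\<^sup>2 * C\<^sup>2\<close>. As \<open>?I\<close> tends to
    \<open>C\<close>, the limit is \<open>(1 - s * C)\<^sup>2\<close>, which vanishes for this
    \<open>s\<close>.\<close>
  let ?s = "1 / C"
  have energy_w: "energy w z \<le> C\<^sup>2"
    using C f(1) mass_f C_pos w by (intro dirichlet_energy_bound) auto
  let ?I = "\<lambda>n. integral {0..1} (\<lambda>x. a_h h x * (?c x * U (r n) x))"
  have "?I \<longlonglongrightarrow> integral {0..1} (\<lambda>x. a_h h x * (?c x * f x))"
  proof (rule dominated_convergence(2))
    show "?c integrable_on {0..1}"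
      using c by (rule integrable_continuous_real)
    fix x :: real assume x: "x \<in> {0..1}"
    show "(\<lambda>n. a_h h x * (?c x * U (r n) x)) \<longlonglongrightarrow> a_h h x * (?c x * f x)"
      by (intro tendsto_mult tendsto_const lim x)
    fix n
    have "a_h h x * (?c x * \<bar>U (r n) x\<bar>) \<le> 1 * (?c x * 1)"
      by (intro mult_mono U_sup x a_h_bounds) auto
    then show "norm (a_h h x * (?c x * U (r n) x)) \<le> ?c x"
      using a_h_bounds by (simp add: abs_mult)
  qed (intro a_h_mult_integrable' continuous_on_mult c U_cont)
  moreover have "?c x * f x = max 0 (f x) powr (p + 1)" for x
    by (cases "f x \<le> 0") (auto simp: powr_add)
  ultimately have I_lim: "?I \<longlonglongrightarrow> C"
    using mass_f by (simp add: mass_def)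
  have "f x = ?s * w x" if x: "x \<in> {0..1}" for x
  proof -
    \<comment> \<open>The sup bound, applied to the difference, turns vanishing energy into a
      pointwise identity for the uniform limit.\<close>
    have "(U (r n) x - ?s * w x)\<^sup>2 \<le> 2 - 2 * ?s * ?I n" for n
    proof -
      have "(U (r n) x - ?s * w x)\<^sup>2 \<le> energy (\<lambda>x. U (r n) x - ?s * w x) (\<lambda>x. G (r n) x - ?s * z x)"
        by (rule admissible_sup[OF energy_minus_dirichlet(1)[OF U(1) w c] x])
      also have "\<dots> = energy (U (r n)) (G (r n)) - 2 * ?s * ?I n + ?s\<^sup>2 * energy w z"
        by (rule energy_minus_dirichlet(2)[OF U(1) w c])
      also have "\<dots> \<le> 1 - 2 * ?s * ?I n + ?s\<^sup>2 * C\<^sup>2"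
        using U(2) energy_w C_pos by (intro add_mono diff_mono mult_left_mono) auto
      finally show ?thesis
        using C_pos by (simp add: power_divide)
    qed
    moreover have "(\<lambda>n. (U (r n) x - ?s * w x)\<^sup>2) \<longlonglongrightarrow> (f x - ?s * w x)\<^sup>2"
      by (intro tendsto_intros lim x)
    moreover have "(\<lambda>n. 2 - 2 * ?s * ?I n) \<longlonglongrightarrow> 2 - 2 * ?s * C"
      by (intro tendsto_intros I_lim)
    ultimately have "(f x - ?s * w x)\<^sup>2 \<le> 2 - 2 * ?s * C"
      by (intro LIMSEQ_le) auto
    then show ?thesis
      using C_pos by simp
  qed
  note f_eq = this
  \<comment> \<open>The maximiser handed on is \<open>w / C\<close> instead of \<open>f\<close>:
    they agree on \<open>[0, 1]\<close>, and \<open>w / C\<close> comes with its derivative.\<close>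
  let ?u = "\<lambda>x. ?s * w x"
  have "mass ?u = mass f"
    unfolding mass_def by (rule integral_cong) (simp add: f_eq)
  moreover have "dirichlet (\<lambda>x. max 0 (?u x) powr p / C) ?u (\<lambda>x. ?s * z x)"
    using f_eq by (intro dirichlet_scale[OF w]) simp
  moreover have "energy ?u (\<lambda>x. ?s * z x) \<le> 1"
    using admissible_scale(2)[OF dirichlet_admissible[OF w], of ?s] energy_w C_pos
    by (simp add: power_divide)
  ultimately show ?thesis
    using that C_pos C mass_f by simp
qed

text \<open>A strong maximum principle. As the datum is nonnegative, \<open>W\<close> decreases from
  \<open>W 0 = 0\<close>, so the quotient \<open>r\<close> decreases to \<open>r 1 = 0\<close> and
  \<open>w \<ge> 0\<close>. An interior zero of \<open>w\<close> would be a minimum with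
  \<open>W = 0\<close>, which forces \<open>r \<le> 0\<close> on all of \<open>(0, 1]\<close> and
  contradicts \<open>w x1 \<noteq> 0\<close>.\<close>

lemma dirichlet_positive:
  assumes w: "dirichlet c w z" and c: "\<And>x. x \<in> {0..1} \<Longrightarrow> 0 \<le> c x"
    and nz: "x1 \<in> {0..1}" "w x1 \<noteq> 0" and x: "x \<in> {0<..<1}"
  shows "0 < w x"
proof -
  \<comment> \<open>\<open>W\<close> is the Wronskian of \<open>sinh (m x)\<close> and \<open>w\<close>, whose sign governs the derivative of \<open>r\<close>\<close>
  define W where "W x = sinh (m * x) * z x - m * cosh (m * x) * w x" for x
  define r where "r x = w x / sinh (m * x)" for x
  let ?S = "{(1 - h) / 2, (1 + h) / 2}"
  have w01: "w 0 = 0" "w 1 = 0" and cz: "continuous_on {0..1} z"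
    using w by (auto simp: dirichlet_def)
  note cw = dirichlet_continuous[OF w]
  have sinh_pos: "0 < sinh (m * x)" if "0 < x" for x
    using that m_pos by simp
  have ds: "((\<lambda>x. sinh (m * x)) has_real_derivative m * cosh (m * x)) (at x)"
    and dt: "((\<lambda>x. cosh (m * x)) has_real_derivative m * sinh (m * x)) (at x)" for x
    by (auto intro!: derivative_eq_intros)
  have cW: "continuous_on {0..1} W"
    unfolding W_def by (intro continuous_intros cw cz)
  have W_mono: "W y \<le> W x" if "0 \<le> x" "x \<le> y" "y \<le> 1" for x y
  proof -
    have "((\<lambda>t. - (sinh (m * t) * (a_h h t * c t))) has_integral (W y - W x)) {x..y}"
    proof (rule fundamental_theorem_of_calculus_interior_strong[of ?S])
      fix t assume t: "t \<in> {x<..<y} - ?S"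
      then have t': "t \<in> {0<..<1}" "t \<in> {0<..<1} - ?S"
        using that by auto
      have "(z has_real_derivative m\<^sup>2 * w t - a_h h t * c t) (at t)"
        using w t' unfolding dirichlet_def by blast
      then have "(W has_real_derivative (m * cosh (m * t) * z t + (m\<^sup>2 * w t - a_h h t * c t) * sinh (m * t))
          - (m * (m * sinh (m * t)) * w t + z t * (m * cosh (m * t)))) (at t)"
        unfolding W_def by (intro DERIV_diff DERIV_mult DERIV_cmult ds dt dirichlet_DERIV[OF w t'(1)])
      then have "(W has_real_derivative - (sinh (m * t) * (a_h h t * c t))) (at t)"
        by (rule DERIV_cong) (simp add: algebra_simps power2_eq_square)
      then show "(W has_vector_derivative - (sinh (m * t) * (a_h h t * c t))) (at t)"
        by (simp add: has_real_derivative_iff_has_vector_derivative)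
    qed (use that cW in \<open>auto intro: continuous_on_subset\<close>)
    then have "0 \<le> - (W y - W x)"
    proof (rule has_integral_nonneg[OF has_integral_neg])
      fix t assume "t \<in> {x..y}"
      then have "0 \<le> sinh (m * t)" "0 \<le> c t"
        using that m_pos c[of t] by auto
      then show "0 \<le> - (- (sinh (m * t) * (a_h h t * c t)))"
        using a_h_bounds by simp
    qed
    then show ?thesis
      by simp
  qed
  have W0: "W 0 = 0"
    by (simp add: W_def w01)
  have dr: "(r has_real_derivative W x / (sinh (m * x))\<^sup>2) (at x)" if "x \<in> {0<..<1}" for x
  proof -
    have "sinh (m * x) \<noteq> 0"
      using sinh_pos[of x] that by (metis greaterThanLessThan_iff less_irrefl)
    then have "(r has_real_derivative (z x * sinh (m * x) - w x * (m * cosh (m * x))) /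
        (sinh (m * x) * sinh (m * x))) (at x)"
      unfolding r_def by (intro DERIV_divide ds dirichlet_DERIV[OF w that])
    then show ?thesis
      by (rule DERIV_cong) (simp add: W_def power2_eq_square algebra_simps)
  qed
  have cr: "continuous_on {x..y} r" if "0 < x" "y \<le> 1" for x y
  proof -
    have "continuous_on {x..y} w"
      using that by (intro continuous_on_subset[OF cw]) auto
    moreover have "sinh (m * t) \<noteq> 0" if "t \<in> {x..y}" for t
      using sinh_pos[of t] that \<open>0 < x\<close> by (metis atLeastAtMost_iff less_irrefl less_le_trans)
    ultimately show ?thesis
      unfolding r_def by (intro continuous_intros) auto
  qed
  have r_mono: "r y \<le> r x" if "0 < x" "x \<le> y" "y \<le> 1" for x y
  proof (rule DERIV_nonpos_imp_decreasing_open[OF \<open>x \<le> y\<close> _ cr[OF that(1,3)]])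
    fix t assume "x < t" "t < y"
    then show "\<exists>d. (r has_real_derivative d) (at t) \<and> d \<le> 0"
      using dr[of t] W_mono[of 0 t] W0 that
      by (intro exI[of _ "W t / (sinh (m * t))\<^sup>2"]) (auto intro: divide_nonpos_nonneg)
  qed
  have w_r: "w x = r x * sinh (m * x)" if "0 < x" for x
    using that m_pos by (simp add: r_def)
  have nonneg: "0 \<le> w x" if "x \<in> {0..1}" for x
  proof (cases "x = 0")
    case False
    have "r 1 = 0"
      by (simp add: r_def w01)
    then have "0 \<le> r x"
      using r_mono[of x 1] that False by simp
    then show ?thesis
      using that False sinh_pos[of x] w_r[of x] by simp
  qed (simp add: w01)
  have "w x \<noteq> 0"
  proof
    assume wx: "w x = 0"
    have "\<forall>y. \<bar>x - y\<bar> < min x (1 - x) \<longrightarrow> w x \<le> w y"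
      using nonneg wx by (auto simp: abs_less_iff)
    then have "z x = 0"
      using x by (intro DERIV_local_min[OF dirichlet_DERIV[OF w x], of "min x (1 - x)"]) auto
    then have Wx: "W x = 0"
      by (simp add: W_def wx)
    have rx: "r x = 0"
      by (simp add: r_def wx)
    \<comment> \<open>Left of \<open>x\<close>, monotonicity gives \<open>W \<ge> W x = 0\<close>,
      so \<open>r\<close> increases up to \<open>r x = 0\<close>; right of \<open>x\<close> it
      decreases from there.\<close>
    have "r y \<le> 0" if "0 < y" "y \<le> 1" for y
    proof (cases "y \<le> x")
      case True
      have "r y \<le> r x"
      proof (rule DERIV_nonneg_imp_increasing_open[OF True _ cr])
        fix t assume t: "y < t" "t < x"
        then have "W x \<le> W t"
          using that x by (intro W_mono) auto
        then show "\<exists>d. (r has_real_derivative d) (at t) \<and> 0 \<le> d"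
          using dr[of t] Wx that x t by (intro exI[of _ "W t / (sinh (m * t))\<^sup>2"]) auto
      qed (use that x in auto)
      then show ?thesis
        using rx by simp
    next
      case False
      then show ?thesis
        using r_mono[of x y] rx x that by simp
    qed
    then have "r x1 \<le> 0" "0 < x1"
      using nz w01 by (cases "x1 = 0"; force)+
    then have "w x1 \<le> 0"
      using w_r[of x1] sinh_pos[of x1] by (simp add: mult_le_0_iff)
    then show False
      using nonneg[OF nz(1)] nz(2) by simp
  qed
  then show ?thesis
    using nonneg[of x] x by simp
qed

section \<open>Splitting an admissible function by a cutoff\<close>

lemma admissible_mult:
  assumes u: "admissible u g" and k: "continuous_on {0..1} k" "finite T"
    and dk: "\<And>x. x \<in> {0<..<1} - T \<Longrightarrow> (k has_real_derivative k' x) (at x)"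
    and k_bd: "\<And>x. \<bar>k x\<bar> \<le> 1" and k'_bd: "\<And>x. \<bar>k' x\<bar> \<le> K"
  shows "admissible (\<lambda>x. k x * u x) (\<lambda>x. g x * k x + k' x * u x)"
proof -
  let ?g = "\<lambda>x. g x * k x + k' x * u x"
  obtain S where S: "finite S" "\<And>x. x \<in> {0<..<1} - S \<Longrightarrow> (u has_real_derivative g x) (at x)"
    using u unfolding admissible_def by blast
  have cont: "continuous_on {0..1} (\<lambda>x. k x * u x)"
    by (intro continuous_on_mult k admissible_continuous[OF u])
  have der: "((\<lambda>x. k x * u x) has_real_derivative ?g x) (at x)" if "x \<in> {0<..<1} - (S \<union> T)" for x
    using DERIV_mult[OF dk S(2), of x] that by (simp add: add.commute)
  \<comment> \<open>As a derivative, \<open>?g\<close> is integrable and therefore measurable. Its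
    square is then integrable by comparison with
    \<open>2 * g\<^sup>2 + 2 * K\<^sup>2 * u\<^sup>2\<close>.\<close>
  have "(?g has_integral (k 1 * u 1 - k 0 * u 0)) {0..1}"
    using S(1) k(2) cont der
    by (intro fundamental_theorem_of_calculus_interior_strong[of "S \<union> T"])
      (auto simp flip: has_real_derivative_iff_has_vector_derivative)
  then have "?g \<in> borel_measurable (lebesgue_on {0..1})"
    by (intro integrable_imp_measurable) blast
  then have meas: "(\<lambda>x. (?g x)\<^sup>2) \<in> borel_measurable (lebesgue_on {0..1})"
    by (rule borel_measurable_power)
  have "(\<lambda>x. (?g x)\<^sup>2) integrable_on {0..1}"
  proof (rule measurable_bounded_by_integrable_imp_integrable[OF meas])
    have "(\<lambda>x. 2 * K\<^sup>2 * (u x)\<^sup>2) integrable_on {0..1}"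
      by (intro integrable_continuous_real continuous_intros admissible_continuous[OF u])
    moreover have "(\<lambda>x. 2 * (g x)\<^sup>2) integrable_on {0..1}"
      using u by (intro integrable_on_mult_right) (simp add: admissible_def)
    ultimately show "(\<lambda>x. 2 * (g x)\<^sup>2 + 2 * K\<^sup>2 * (u x)\<^sup>2) integrable_on {0..1}"
      by (intro integrable_add)
    fix x
    have "(k x)\<^sup>2 \<le> 1"
      using k_bd[of x] by (simp add: abs_square_le_1)
    then have "(g x)\<^sup>2 * (k x)\<^sup>2 \<le> (g x)\<^sup>2 * 1"
      by (rule mult_left_mono) simp
    moreover have "(k' x)\<^sup>2 \<le> K\<^sup>2"
      using k'_bd[of x] by (subst abs_le_square_iff[symmetric]) linarith
    then have "(k' x)\<^sup>2 * (u x)\<^sup>2 \<le> K\<^sup>2 * (u x)\<^sup>2"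
      by (rule mult_right_mono) simp
    moreover have "(?g x)\<^sup>2 \<le> 2 * ((g x)\<^sup>2 * (k x)\<^sup>2) + 2 * ((k' x)\<^sup>2 * (u x)\<^sup>2)"
      using zero_le_power2[of "g x * k x - k' x * u x"] by (simp add: power2_eq_square algebra_simps)
    ultimately have "(?g x)\<^sup>2 \<le> 2 * (g x)\<^sup>2 + 2 * (K\<^sup>2 * (u x)\<^sup>2)"
      by linarith
    then show "norm ((?g x)\<^sup>2) \<le> 2 * (g x)\<^sup>2 + 2 * K\<^sup>2 * (u x)\<^sup>2"
      by simp
  qed auto
  moreover have "\<exists>S. finite S \<and> (\<forall>x\<in>{0<..<1} - S. ((\<lambda>x. k x * u x) has_real_derivative ?g x) (at x))"
    using S(1) k(2) der by (intro exI[of _ "S \<union> T"]) auto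
  ultimately show ?thesis
    using u cont unfolding admissible_def by simp
qed

definition cutoff :: "real \<Rightarrow> real" where
  "cutoff x = max 0 (min 1 (((1 + h) / 2 - x) / h))"

definition cutoff' :: "real \<Rightarrow> real" where
  "cutoff' x = (if (1 - h) / 2 < x \<and> x < (1 + h) / 2 then - 1 / h else 0)"

lemma cutoff_left: "x \<le> (1 - h) / 2 \<Longrightarrow> cutoff x = 1"
  using h_pos by (auto simp: cutoff_def field_simps)

lemma cutoff_right: "(1 + h) / 2 \<le> x \<Longrightarrow> cutoff x = 0"
  using h_pos by (auto simp: cutoff_def field_simps)

lemma cutoff_mid: "(1 - h) / 2 \<le> x \<Longrightarrow> x \<le> (1 + h) / 2 \<Longrightarrow> cutoff x = ((1 + h) / 2 - x) / h"
  using h_pos by (auto simp: cutoff_def field_simps)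

lemma cutoff_bounds: "0 \<le> cutoff x" "cutoff x \<le> 1"
  by (auto simp: cutoff_def)

text \<open>The ramp is centred at \<open>1 / 2\<close>, so reflection exchanges the two members of
  the partition of unity.\<close>

lemma cutoff_reflect: "cutoff (1 - x) = 1 - cutoff x"
proof -
  consider "x \<le> (1 - h) / 2" | "(1 + h) / 2 \<le> x" | "(1 - h) / 2 \<le> x" "x \<le> (1 + h) / 2"
    by linarith
  then show ?thesis
  proof cases
    case 3
    then have "cutoff x = ((1 + h) / 2 - x) / h" "cutoff (1 - x) = ((1 + h) / 2 - (1 - x)) / h"
      by (auto intro!: cutoff_mid)
    then show ?thesis
      using h_pos by (simp only:) (simp add: field_simps)
  qed (auto simp: cutoff_left cutoff_right)
qed

lemma continuous_on_cutoff: "continuous_on S cutoff"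
  unfolding cutoff_def using h_pos by (intro continuous_intros) auto

lemma cutoff_DERIV:
  assumes "x \<notin> {(1 - h) / 2, (1 + h) / 2}"
  shows "(cutoff has_real_derivative cutoff' x) (at x)"
proof -
  consider "x < (1 - h) / 2" | "(1 + h) / 2 < x" | "(1 - h) / 2 < x" "x < (1 + h) / 2"
    using assms by fastforce
  then show ?thesis
  proof cases
    case 1
    have "((\<lambda>_. 1) has_real_derivative cutoff' x) (at x)"
      using 1 by (simp add: cutoff'_def)
    then show ?thesis
      by (rule has_field_derivative_transform_within_open[of _ _ _ "{..<(1 - h) / 2}"])
        (use 1 in \<open>auto simp: cutoff_left\<close>)
  next
    case 2
    have "((\<lambda>_. 0) has_real_derivative cutoff' x) (at x)"
      using 2 by (simp add: cutoff'_def)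
    then show ?thesis
      by (rule has_field_derivative_transform_within_open[of _ _ _ "{(1 + h) / 2<..}"])
        (use 2 in \<open>auto simp: cutoff_right\<close>)
  next
    case 3
    have "((\<lambda>x. ((1 + h) / 2 - x) / h) has_real_derivative cutoff' x) (at x)"
      using 3 by (auto simp: cutoff'_def intro!: derivative_eq_intros)
    then show ?thesis
      by (rule has_field_derivative_transform_within_open[of _ _ _ "{(1 - h) / 2<..<(1 + h) / 2}"])
        (use 3 in \<open>auto simp: cutoff_mid\<close>)
  qed
qed

lemma cutoff'_bound: "\<bar>cutoff' x\<bar> \<le> 1 / h"
  using h_pos by (auto simp: cutoff'_def)

lemma square_add_le:
  fixes a b e :: real
  assumes "0 < e"
  shows "(a + b)\<^sup>2 \<le> (1 + e) * a\<^sup>2 + (1 + 1 / e) * b\<^sup>2"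
proof -
  have "0 \<le> (e * a - b)\<^sup>2 / e"
    using assms by simp
  also have "\<dots> = e * a\<^sup>2 - 2 * a * b + b\<^sup>2 / e"
    using assms by (simp add: power2_eq_square field_simps)
  finally show ?thesis
    using assms by (simp add: power2_eq_square algebra_simps)
qed

text \<open>The squares of \<open>cutoff\<close> and \<open>1 - cutoff\<close> add up to at most 1,
  so extra energy comes only from the slope \<open>1 / h\<close> of the ramp. The weighted square
  inequality with \<open>e = 1 / m\<close> costs a factor \<open>1 + 1 / m\<close> on
  \<open>g\<^sup>2\<close> and produces a term \<open>(1 + m) * 2 / h\<^sup>2 * u\<^sup>2\<close>,
  which is measured against \<open>m\<^sup>2 * u\<^sup>2\<close>.\<close>

lemma energy_cutoff:
  assumes u: "admissible u g"
  defines "v \<equiv> \<lambda>x. cutoff x * u x" and "k \<equiv> \<lambda>x. g x * cutoff x + cutoff' x * u x"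
    and "v1 \<equiv> \<lambda>x. (1 - cutoff x) * u x" and "k1 \<equiv> \<lambda>x. g x * (1 - cutoff x) + - cutoff' x * u x"
  shows "admissible v k" "admissible v1 k1"
    and "energy v k + energy v1 k1 \<le> (1 + 1 / m + (1 + m) * (2 / (h\<^sup>2 * m\<^sup>2))) * energy u g"
proof -
  let ?S = "{(1 - h) / 2, (1 + h) / 2}"
  let ?A = "1 + 1 / m + (1 + m) * (2 / (h\<^sup>2 * m\<^sup>2))"
  show v: "admissible v k"
    unfolding v_def k_def
    by (rule admissible_mult[OF u continuous_on_cutoff, of ?S _ "1 / h"])
      (use cutoff_DERIV cutoff_bounds cutoff'_bound in auto)
  show v1: "admissible v1 k1"
    unfolding v1_def k1_def
  proof (rule admissible_mult[OF u, of _ ?S _ "1 / h"])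
    show "((\<lambda>x. 1 - cutoff x) has_real_derivative - cutoff' x) (at x)" if "x \<in> {0<..<1} - ?S" for x
      using DERIV_diff[OF DERIV_const cutoff_DERIV, of x 1] that by simp
  qed (use cutoff_bounds cutoff'_bound in \<open>auto intro!: continuous_intros continuous_on_cutoff\<close>)
  have "energy v k + energy v1 k1 = integral {0..1} (\<lambda>x. ((k x)\<^sup>2 + m\<^sup>2 * (v x)\<^sup>2) + ((k1 x)\<^sup>2 + m\<^sup>2 * (v1 x)\<^sup>2))"
    unfolding energy_def by (intro integral_add[symmetric] admissible_integrable v v1)
  also have "\<dots> \<le> integral {0..1} (\<lambda>x. ?A * ((g x)\<^sup>2 + m\<^sup>2 * (u x)\<^sup>2))"
  proof (rule integral_le)
    fix x
    let ?c = "cutoff x" and ?d = "cutoff' x"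
    have c: "?c\<^sup>2 + (1 - ?c)\<^sup>2 \<le> 1"
      using mult_nonneg_nonneg[of ?c "1 - ?c"] cutoff_bounds by (simp add: power2_eq_square algebra_simps)
    have d: "?d\<^sup>2 \<le> 1 / h\<^sup>2"
      using cutoff'_bound[of x] h_pos by (auto simp: cutoff'_def power_divide)
    let ?D = "?d\<^sup>2 * (u x)\<^sup>2"
    have "(k x)\<^sup>2 \<le> (1 + 1 / m) * ((g x)\<^sup>2 * ?c\<^sup>2) + (1 + m) * ?D"
      using square_add_le[of "1 / m" "g x * ?c" "?d * u x"] m_pos
      by (simp add: k_def power_mult_distrib)
    moreover have "(k1 x)\<^sup>2 \<le> (1 + 1 / m) * ((g x)\<^sup>2 * (1 - ?c)\<^sup>2) + (1 + m) * ?D"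
      using square_add_le[of "1 / m" "g x * (1 - ?c)" "- ?d * u x"] m_pos
      by (simp only: k1_def power_mult_distrib power2_minus) simp
    ultimately have "(k x)\<^sup>2 + (k1 x)\<^sup>2 \<le> ((1 + 1 / m) * ((g x)\<^sup>2 * ?c\<^sup>2) + (1 + m) * ?D) +
        ((1 + 1 / m) * ((g x)\<^sup>2 * (1 - ?c)\<^sup>2) + (1 + m) * ?D)"
      by (rule add_mono)
    also have "\<dots> = (1 + 1 / m) * ((g x)\<^sup>2 * (?c\<^sup>2 + (1 - ?c)\<^sup>2)) + (1 + m) * (2 * ?D)"
      by (simp only: mult_2 distrib_left add_ac)
    also have "\<dots> \<le> (1 + 1 / m) * ((g x)\<^sup>2 * 1) + (1 + m) * (2 * (1 / h\<^sup>2 * (u x)\<^sup>2))"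
      using c d m_pos by (intro add_mono mult_left_mono mult_right_mono) auto
    finally have *: "(k x)\<^sup>2 + (k1 x)\<^sup>2 \<le> (1 + 1 / m) * ((g x)\<^sup>2 * 1) + (1 + m) * (2 * (1 / h\<^sup>2 * (u x)\<^sup>2))" .
    have 1: "(k x)\<^sup>2 + (k1 x)\<^sup>2 \<le> (1 + 1 / m) * (g x)\<^sup>2 + (1 + m) * (2 / (h\<^sup>2 * m\<^sup>2)) * (m\<^sup>2 * (u x)\<^sup>2)"
    proof -
      have "(1 + m) * (2 / (h\<^sup>2 * m\<^sup>2)) * (m\<^sup>2 * (u x)\<^sup>2) = (1 + m) * (2 * (1 / h\<^sup>2 * (u x)\<^sup>2))"
        using m_pos by simp
      with * show ?thesis
        by (simp only: mult_1_right)
    qed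
    have "m\<^sup>2 * (v x)\<^sup>2 + m\<^sup>2 * (v1 x)\<^sup>2 = m\<^sup>2 * (u x)\<^sup>2 * (?c\<^sup>2 + (1 - ?c)\<^sup>2)"
      unfolding v_def v1_def by (simp only: power_mult_distrib distrib_left mult_ac)
    also have "\<dots> \<le> m\<^sup>2 * (u x)\<^sup>2 * 1"
      using c by (intro mult_left_mono) auto
    finally have 2: "m\<^sup>2 * (v x)\<^sup>2 + m\<^sup>2 * (v1 x)\<^sup>2 \<le> m\<^sup>2 * (u x)\<^sup>2"
      by simp
    have "0 \<le> (1 + m) * (2 / (h\<^sup>2 * m\<^sup>2)) * (g x)\<^sup>2" "0 \<le> 1 / m * (m\<^sup>2 * (u x)\<^sup>2)"
      using m_pos by auto
    with 1 2 show "((k x)\<^sup>2 + m\<^sup>2 * (v x)\<^sup>2) + ((k1 x)\<^sup>2 + m\<^sup>2 * (v1 x)\<^sup>2) \<le> ?A * ((g x)\<^sup>2 + m\<^sup>2 * (u x)\<^sup>2)"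
      unfolding distrib_right distrib_left by linarith
  qed (intro integrable_add integrable_on_mult_right admissible_integrable v v1 u)+
  also have "\<dots> = ?A * energy u g"
    unfolding energy_def by (rule integral_mult_right)
  finally show "energy v k + energy v1 k1 \<le> ?A * energy u g" .
qed

text \<open>Wherever the weight is nonzero the cutoff is 0 or 1, so the two masses add up exactly in
  spite of the nonlinear power. For symmetric \<open>u\<close>, reflection makes them equal.\<close>

lemma mass_cutoff_symmetric:
  assumes u: "continuous_on {0..1} u" and sym: "\<And>x. x \<in> {0..1} \<Longrightarrow> u (1 - x) = u x"
  shows "mass (\<lambda>x. cutoff x * u x) = mass u / 2" "mass (\<lambda>x. (1 - cutoff x) * u x) = mass u / 2"
proof -
  let ?f = "\<lambda>x. a_h h x * max 0 (cutoff x * u x) powr (p + 1)"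
  let ?f1 = "\<lambda>x. a_h h x * max 0 ((1 - cutoff x) * u x) powr (p + 1)"
  have "integral {0..1} ?f1 = integral {0..1} (\<lambda>x. ?f (1 - x))"
    by (rule integral_cong) (simp add: a_h_reflect cutoff_reflect sym)
  also have "\<dots> = integral {0..1} ?f"
    by (rule integral_reflect_unit)
  finally have eq: "mass (\<lambda>x. (1 - cutoff x) * u x) = mass (\<lambda>x. cutoff x * u x)"
    by (simp add: mass_def)
  have "?f x + ?f1 x = a_h h x * max 0 (u x) powr (p + 1)" for x
  proof -
    consider "x \<le> (1 - h) / 2" | "(1 + h) / 2 \<le> x" | "(1 - h) / 2 < x" "x < (1 + h) / 2"
      by linarith
    then show ?thesis
      by cases (auto simp: cutoff_left cutoff_right a_h_def)
  qed
  then have "mass u = integral {0..1} (\<lambda>x. ?f x + ?f1 x)"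
    by (simp add: mass_def)
  also have "\<dots> = mass (\<lambda>x. cutoff x * u x) + mass (\<lambda>x. (1 - cutoff x) * u x)"
    unfolding mass_def
    by (intro integral_add mass_integrable continuous_intros continuous_on_cutoff u)
  finally show "mass (\<lambda>x. cutoff x * u x) = mass u / 2" "mass (\<lambda>x. (1 - cutoff x) * u x) = mass u / 2"
    using eq by simp_all
qed

text \<open>If \<open>u\<close> were symmetric, one of its two parts would have mass
  \<open>C / 2\<close> and energy at most \<open>?A / 2\<close>. Rescaling it by
  \<open>sqrt (2 / ?A)\<close> restores the constraint, and maximality of \<open>C\<close> then
  yields \<open>2 \<le> ?A * 2 powr (2 / (p + 1))\<close>. This contradicts \<open>large\<close>,
  because the exponents \<open>(p - 1) / (p + 1)\<close> and \<open>2 / (p + 1)\<close> add up to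
  1.\<close>

lemma maximiser_asymmetric:
  assumes C: "\<And>v k. admissible v k \<Longrightarrow> energy v k \<le> 1 \<Longrightarrow> mass v \<le> C" "0 < C"
    and u: "admissible u g" "mass u = C" "energy u g \<le> 1"
    and large: "1 + 1 / m + (1 + m) * (2 / (h\<^sup>2 * m\<^sup>2)) < 2 powr ((p - 1) / (p + 1))"
  shows "asymmetric u"
proof (rule ccontr)
  let ?A = "1 + 1 / m + (1 + m) * (2 / (h\<^sup>2 * m\<^sup>2))"
  assume "\<not> asymmetric u"
  then have sym: "\<And>x. x \<in> {0..1} \<Longrightarrow> u (1 - x) = u x"
    unfolding asymmetric_def by metis
  have A: "0 < ?A"
    using m_pos by (intro add_pos_nonneg) auto
  have bound: "?A * energy u g \<le> ?A"
    using A u(3) by (intro mult_left_le) auto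
  have half: "a \<le> c / 2 \<or> b \<le> c / 2" if "a + b \<le> c" for a b c :: real
    using that by linarith
  have "\<exists>y k. admissible y k \<and> energy y k \<le> ?A / 2 \<and> mass y = C / 2"
  proof -
    note adm = energy_cutoff(1,2)[OF u(1)]
    note mass = mass_cutoff_symmetric[OF admissible_continuous[OF u(1)] sym, unfolded u(2)]
    have "energy (\<lambda>x. cutoff x * u x) (\<lambda>x. g x * cutoff x + cutoff' x * u x) \<le> ?A / 2 \<or>
        energy (\<lambda>x. (1 - cutoff x) * u x) (\<lambda>x. g x * (1 - cutoff x) + - cutoff' x * u x) \<le> ?A / 2"
      by (rule half[OF order_trans[OF energy_cutoff(3)[OF u(1)] bound]])
    then show ?thesis
      using adm mass by blast
  qed
  then obtain y k where y: "admissible y k" "energy y k \<le> ?A / 2" "mass y = C / 2"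
    by blast
  define s where "s = sqrt (2 / ?A)"
  have s: "0 < s" "s\<^sup>2 = 2 / ?A"
    using A by (auto simp: s_def)
  have "s\<^sup>2 * energy y k \<le> s\<^sup>2 * (?A / 2)"
    using y(2) by (intro mult_left_mono) auto
  also have "\<dots> = 1"
  proof -
    have "2 / a * (a / 2) = 1" if "0 < a" for a :: real
      using that by simp
    from this[OF A] show ?thesis
      by (simp only: s(2))
  qed
  finally have "mass (\<lambda>x. s * y x) \<le> C"
    using C(1)[of "\<lambda>x. s * y x" "\<lambda>x. s * k x"] admissible_scale[OF y(1), of s] by simp
  then have "s powr (p + 1) * (C / 2) \<le> C"
    using s(1) y(3) by (simp add: mass_scale)
  then have "s powr (p + 1) \<le> 2"
    using C(2) by simp
  then have "(s powr (p + 1)) powr (2 / (p + 1)) \<le> 2 powr (2 / (p + 1))"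
    using p_gt_1 by (intro powr_mono2) auto
  moreover have "(p + 1) * (2 / (p + 1)) = 2"
    using p_gt_1 by (simp add: field_simps)
  then have "(s powr (p + 1)) powr (2 / (p + 1)) = s\<^sup>2"
    using s(1) by (simp only: powr_powr powr_numeral)
  ultimately have "2 \<le> ?A * 2 powr (2 / (p + 1))"
    using A s(2) by (simp add: field_simps)
  also have "\<dots> < 2 powr ((p - 1) / (p + 1)) * 2 powr (2 / (p + 1))"
    using large by (intro mult_strict_right_mono) auto
  also have "\<dots> = 2 powr ((p - 1) / (p + 1) + 2 / (p + 1))"
    by (rule powr_add[symmetric])
  also have "(p - 1) / (p + 1) + 2 / (p + 1) = 1"
    using p_gt_1 by (simp flip: add_divide_distrib)
  finally show False
    by simp
qed

section \<open>From the maximiser to a solution and its reflection\<close>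

lemma asymmetric_positive_solution_exists:
  assumes "1 + 1 / m + (1 + m) * (2 / (h\<^sup>2 * m\<^sup>2)) < 2 powr ((p - 1) / (p + 1))"
  obtains u where "is_positive_solution (- m\<^sup>2) p (a_h h) u" "asymmetric u"
    "is_positive_solution (- m\<^sup>2) p (a_h h) (\<lambda>x. u (1 - x))"
proof -
  let ?S = "{(1 - h) / 2, (1 + h) / 2}"
  obtain C u z where C: "0 < C" "\<And>v k. admissible v k \<Longrightarrow> energy v k \<le> 1 \<Longrightarrow> mass v \<le> C"
    and u: "mass u = C" "energy u z \<le> 1" "dirichlet (\<lambda>x. max 0 (u x) powr p / C) u z"
    using maximiser_exists by metis
  \<comment> \<open>The maximum principle needs a nontrivial function; this follows from the
    positive mass.\<close>
  have "\<exists>x1\<in>{0..1}. u x1 \<noteq> 0"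
  proof (rule ccontr)
    assume "\<not> (\<exists>x1\<in>{0..1}. u x1 \<noteq> 0)"
    then have "mass u = integral {0..1} (\<lambda>x::real. 0)"
      unfolding mass_def by (intro integral_cong) auto
    then show False
      using u(1) C(1) by simp
  qed
  then have pos: "0 < u x" if "x \<in> {0<..<1}" for x
    using dirichlet_positive[OF u(3) _ _ _ that] C(1) by force
  \<comment> \<open>the amplitude for which the Lagrange multiplier becomes 1\<close>
  define s where "s = C powr (- 1 / (p - 1))"
  have s: "0 < s" "s / C = s powr p"
  proof -
    show "0 < s"
      using C(1) by (simp add: s_def)
    have "s powr p = s powr (1 + (p - 1))"
      by simp
    also have "\<dots> = s * s powr (p - 1)"
      using \<open>0 < s\<close> unfolding powr_add by simp
    also have "s powr (p - 1) = 1 / C"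
      unfolding s_def powr_powr using p_gt_1 C(1) by (simp add: powr_minus_divide)
    finally show "s / C = s powr p"
      by simp
  qed
  define w y where "w x = s * u x" and "y x = s * z x" for x
  have "dirichlet (\<lambda>x. s * (max 0 (u x) powr p / C)) w y"
    unfolding w_def y_def by (rule dirichlet_scale[OF u(3)]) simp
  note w = this
  have w_pos: "0 < w x" if "x \<in> {0<..<1}" for x
    using pos[OF that] s(1) by (simp add: w_def)
  have w01: "w 0 = 0" "w 1 = 0" and cy: "continuous_on {0..1} y"
    using w by (auto simp: dirichlet_def)
  note cw = dirichlet_continuous[OF w] and dw = dirichlet_DERIV[OF w]
  \<comment> \<open>Since \<open>u > 0\<close>, the positive part disappears, and
    \<open>s / C = s powr p\<close> turns the scaled datum into \<open>w powr p\<close>.\<close>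
  have dy: "(y has_real_derivative - (- m\<^sup>2 * w x + a_h h x * w x powr p)) (at x)"
    if "x \<in> {0<..<1} - ?S" for x
  proof -
    have "s * (max 0 (u x) powr p / C) = w x powr p"
      using pos[of x] that s by (simp add: w_def powr_mult max_def)
        (metis mult.commute times_divide_eq_left)
    moreover have "(y has_real_derivative m\<^sup>2 * w x - a_h h x * (s * (max 0 (u x) powr p / C))) (at x)"
      using w that unfolding dirichlet_def by blast
    ultimately show ?thesis
      by simp
  qed
  have "is_positive_solution (- m\<^sup>2) p (a_h h) w"
    by (rule is_positive_solutionI[of ?S _ _ _ y])
      (use p_gt_1 a_h_bounds cw cy dw dy w01 w_pos in auto)
  moreover have "is_positive_solution (- m\<^sup>2) p (a_h h) (\<lambda>x. w (1 - x))"
  proof (rule is_positive_solutionI[of ?S _ _ _ "\<lambda>x. - y (1 - x)"])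
    show "continuous_on {0..1} (\<lambda>x. w (1 - x))" "continuous_on {0..1} (\<lambda>x. - y (1 - x))"
      by (intro continuous_on_minus continuous_on_compose2[OF cw] continuous_on_compose2[OF cy]
          continuous_intros; auto)+
    fix x assume x: "x \<in> {0<..<1} - ?S"
    then have x': "1 - x \<in> {0<..<1} - ?S"
      by auto
    have d: "((\<lambda>x. 1 - x) has_real_derivative - 1) (at x)"
      by (auto intro!: derivative_eq_intros)
    show "((\<lambda>x. w (1 - x)) has_real_derivative - y (1 - x)) (at x)"
      using DERIV_chain2[OF dw d] x' by simp
    show "((\<lambda>x. - y (1 - x)) has_real_derivative
        - (- m\<^sup>2 * w (1 - x) + a_h h x * w (1 - x) powr p)) (at x)"
      using DERIV_minus[OF DERIV_chain2[OF dy[OF x'] d]] by (simp add: a_h_reflect)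
  qed (use p_gt_1 a_h_bounds w01 w_pos in auto)
  moreover have "asymmetric u"
    using maximiser_asymmetric[OF C(2,1) dirichlet_admissible[OF u(3)] u(1,2) assms] .
  then have "asymmetric w"
    using s(1) by (auto simp: asymmetric_def w_def)
  ultimately show ?thesis
    using that by blast
qed

end

section \<open>The threshold for \<open>lam\<close> and the pair of solutions\<close>

theorem theorem4p1:
  fixes p :: real
  assumes "p > 1"
  shows "\<forall>h. 0 < h \<and> h < 1 \<longrightarrow>
           (\<exists>lt<0. \<forall>lam\<le>lt. \<exists>u1 u2.
              is_positive_solution lam p (a_h h) u1 \<and> asymmetric u1 \<and>
              is_positive_solution lam p (a_h h) u2 \<and> asymmetric u2 \<and>
              (\<exists>x\<in>{0..1}. u1 x \<noteq> u2 x))"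
proof (intro allI impI)
  fix h :: real
  assume h: "0 < h \<and> h < 1"
  let ?k = "2 powr ((p - 1) / (p + 1)) :: real"
  let ?B = "1 + 4 / h\<^sup>2"
  \<comment> \<open>For \<open>m \<ge> 1\<close>, the estimate \<open>1 + m \<le> 2 * m\<close>
    bounds the relative energy cost of the cutoff by \<open>?B / m\<close>. This is below
    \<open>?k - 1\<close> once \<open>m > ?B / (?k - 1)\<close>; the summand 1 gives both this
    strict inequality and \<open>M > 1\<close>.\<close>
  define M where "M = 1 + ?B / (?k - 1)"
  have k: "1 < ?k"
    using assms by (intro gr_one_powr) auto
  have B: "0 < ?B"
    by (intro add_pos_nonneg) auto
  have M: "1 < M"
    using k B by (simp add: M_def)
  have "\<exists>u1 u2. is_positive_solution lam p (a_h h) u1 \<and> asymmetric u1 \<and>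
      is_positive_solution lam p (a_h h) u2 \<and> asymmetric u2 \<and> (\<exists>x\<in>{0..1}. u1 x \<noteq> u2 x)"
    if lam: "lam \<le> - M\<^sup>2" for lam
  proof -
    define m where "m = sqrt (- lam)"
    have "lam \<le> 0"
      using lam zero_le_power2[of M] by linarith
    then have lam_m: "lam = - m\<^sup>2"
      by (simp add: m_def)
    have m: "M \<le> m"
      using lam M unfolding m_def by (intro real_le_rsqrt) auto
    then have "0 < m"
      using M by simp
    interpret indefinite_weight p h m
      using assms h \<open>0 < m\<close> by unfold_locales auto
    have "(1 + m) * (2 / (h\<^sup>2 * m\<^sup>2)) \<le> (2 * m) * (2 / (h\<^sup>2 * m\<^sup>2))"
      using m M by (intro mult_right_mono) auto
    also have "\<dots> = 4 / h\<^sup>2 / m"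
      using \<open>0 < m\<close> by (simp add: power2_eq_square)
    finally have "1 + 1 / m + (1 + m) * (2 / (h\<^sup>2 * m\<^sup>2)) \<le> 1 + ?B / m"
      by (simp add: add_divide_distrib)
    also have "?B < (?k - 1) * m"
    proof -
      have "?B / (?k - 1) < m"
        using m by (simp add: M_def)
      then show ?thesis
        using k by (simp add: pos_divide_less_eq mult.commute)
    qed
    then have "?B / m < ?k - 1"
      using \<open>0 < m\<close> by (simp only: pos_divide_less_eq)
    then have "1 + ?B / m < ?k"
      by linarith
    finally obtain u where u: "is_positive_solution (- m\<^sup>2) p (a_h h) u" "asymmetric u"
      "is_positive_solution (- m\<^sup>2) p (a_h h) (\<lambda>x. u (1 - x))"
      using asymmetric_positive_solution_exists by blast
    \<comment> \<open>A point where \<open>u\<close> differs from its reflection shows that the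
      reflection is asymmetric and that the two solutions are distinct.\<close>
    moreover have "asymmetric (\<lambda>x. u (1 - x))" "\<exists>x\<in>{0..1}. u x \<noteq> u (1 - x)"
      using u(2) unfolding asymmetric_def by (auto intro: bexI simp: eq_commute)
    ultimately show ?thesis
      unfolding lam_m by blast
  qed
  then show "\<exists>lt<0. \<forall>lam\<le>lt. \<exists>u1 u2.
      is_positive_solution lam p (a_h h) u1 \<and> asymmetric u1 \<and>
      is_positive_solution lam p (a_h h) u2 \<and> asymmetric u2 \<and> (\<exists>x\<in>{0..1}. u1 x \<noteq> u2 x)"
    using M by (intro exI[of _ "- M\<^sup>2"]) auto
qed

end
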